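(* Let $\Gamma$ be a rectifiable Jordan curve which is locally a Carleson curve at $t\in\Gamma$, let $w:\Gamma\to[0,\infty]$ be a weight, and let $p\in\mathcal{P}_t$. If $w\in A_{L^{p(\cdot)}}(\Gamma,t)$, then $\log w\in BMO(\Gamma,t)$ and $$\alpha(Q_tw)=\frac1{p(t)}+\alpha(V_tw),\qquad\beta(Q_tw)=\frac1{p(t)}+\beta(V_tw).$$
   Context: Curve. A rectifiable Jordan curve $\Gamma\subset\mathbb{C}$ (homeomorphic to a circle) carries Lebesgue length measure $|d\tau|$; $|\Omega|$ is the measure of a measurable $\Omega\subset\Gamma$. For $t\in\Gamma$, $R>0$: $\Gamma(t,R)=\{\tau\in\Gamma:|\tau-t|<R\}$, $d_t=\max_{\tau\in\Gamma}|\tau-t|$, $\Delta(t,R)=\Gamma(t,R)\setminus\Gamma(t,R/2)$. $\Gamma$ is locally a Carleson curve at $t$ if $\sup_{R>0}|\Gamma(t,R)|/R<\infty$. A weight is a measurable $w:\Gamma\to[0,\infty]$ with $0<w<\infty$ a.e. Nakano spaces. For measurable $p:\Gamma\to[1,\infty)$ let $m(f,p)=\int_\Gamma|f(\tau)|^{p(\tau)}|d\tau|$; $X=L^{p(\cdot)}$ is the space of measurable $f:\Gamma\to\mathbb{C}$ with $m(\lambda f,p)<\infty$ for some $\lambda>0$, with norm $\|f\|_X=\inf\{\lambda>0:m(f/\lambda,p)\le1\}$. Its associate space $X'$ has norm $\|g\|_{X'}=\sup\{\int_\Gamma|fg|\,|d\tau|:\|f\|_X\le1\}$. $\mathcal{P}_t$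 is the class of continuous $p:\Gamma\to(1,\infty)$ for which there is $A_t>0$ with $|p(\tau)-p(t)|\le A_t/(-\log|\tau-t|)$ for all $\tau\in\Gamma(t,1/2)$. $A_X(\Gamma,t)$ is the class of weights $w$ with $\sup_{R>0}\frac1R\|w\chi_{\Gamma(t,R)}\|_X\|\chi_{\Gamma(t,R)}/w\|_{X'}<\infty$. $BMO(\Gamma,t)$: $f\in L^1(\Gamma)$ real-valued (possibly $\pm\infty$) with $\sup_{R>0}\frac1{|\Gamma(t,R)|}\int_{\Gamma(t,R)}|f-\Omega_t(f,R)|\,|d\tau|<\infty$, where $\Omega_t(f,R)=\frac1{|\Gamma(t,R)|}\int_{\Gamma(t,R)}f\,|d\tau|$. Indices. $\Phi:(0,\infty)\to(0,\infty]$ is regular if bounded in an open neighborhood of $1$, submultiplicative if $\Phi(xy)\le\Phi(x)\Phi(y)$ for all $x,y>0$. For regular submultiplicative $\Phi$: $\alpha(\Phi)=\sup_{x\in(0,1)}\frac{\log\Phi(x)}{\log x}$, $\beta(\Phi)=\inf_{x\in(1,\infty)}\frac{\log\Phi(x)}{\log x}$. Put $G_w(R_1,R_2)=\|w\chi_{\Delta(t,R_1)}\|_X\|\chi_{\Delta(t,R_2)}/w\|_{X'}/|\Delta(t,R_2)|$; $(Q_tw)(x)=\sup_{0<R\le d_t}G_w(xR,R)$ for $x\in(0,1]$ and $(Q_tw)(x)=\sup_{0<R\le d_t}G_w(R,x^{-1}R)$ for $x>1$; $H_w(R_1,R_2)=\exp(\Omega_t(\log w,R_1))/\exp(\Omega_t(\log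 w,R_2))$; $(V_tw)(x)=\sup_{0<R\le d_t}H_w(xR,R)$ for $x\in(0,1]$ and $(V_tw)(x)=\sup_{0<R\le d_t}H_w(R,x^{-1}R)$ for $x>1$. (Under the hypotheses $Q_tw$ and $V_tw$ are regular and submultiplicative.) *)

theory Defs
  imports "HOL-Analysis.Analysis"
begin

section \<open>Rectifiable Jordan curves and length measure\<close>

definition path_length_on :: "(real \<Rightarrow> complex) \<Rightarrow> real \<Rightarrow> real \<Rightarrow> ennreal" where
  "path_length_on g a b =
     (SUP (n, x) \<in> {(n :: nat, x :: nat \<Rightarrow> real). mono_on {..n} x \<and> x ` {..n} \<subseteq> {a..b}}.
        \<Sum>i<n. ennreal (dist (g (x i)) (g (x (Suc i)))))"

text \<open>A curve is given by a simple closed parametrization on the unit interval;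
  the curve itself is \<open>path_image g\<close>.\<close>

definition rectifiable_jordan_curve :: "(real \<Rightarrow> complex) \<Rightarrow> bool" where
  "rectifiable_jordan_curve g \<longleftrightarrow>
     simple_path g \<and> pathfinish g = pathstart g \<and> path_length_on g 0 1 < \<infinity>"

text \<open>The length measure is the image under \<open>g\<close> of the Stieltjes measure of the arc-length
  function, completed so that its measurable sets are the Lebesgue measurable subsets of the
  curve. The arc-length function is extended constantly outside the unit interval.\<close>

definition arclength_measure :: "(real \<Rightarrow> complex) \<Rightarrow> complex measure" where
  "arclength_measure g =
     completion (distr
       (restrict_space
          (interval_measure (\<lambda>s. enn2real (path_length_on g 0 (max 0 (min 1 s))))) {0..1})
       (restrict_space borel (path_image g)) g)"

lemma space_arclength_measure [simp]: "space (arclength_measure g) = path_image g"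
  by (simp add: arclength_measure_def space_restrict_space)

text \<open>From here on \<open>M\<close> is the length measure, so \<open>space M\<close> is the curve.\<close>

definition portion :: "complex measure \<Rightarrow> complex \<Rightarrow> real \<Rightarrow> complex set" where
  "portion M t R = {\<tau> \<in> space M. cmod (\<tau> - t) < R}"

definition annulus :: "complex measure \<Rightarrow> complex \<Rightarrow> real \<Rightarrow> complex set" where
  "annulus M t R = portion M t R - portion M t (R / 2)"

definition max_dist :: "complex measure \<Rightarrow> complex \<Rightarrow> real" where
  "max_dist M t = (SUP \<tau>\<in>space M. cmod (\<tau> - t))"

definition locally_Carleson :: "complex measure \<Rightarrow> complex \<Rightarrow> bool" where
  "locally_Carleson M t \<longleftrightarrow> (SUP R\<in>{0<..}. emeasure M (portion M t R) / ennreal R) < \<infinity>"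

definition weight :: "complex measure \<Rightarrow> (complex \<Rightarrow> ennreal) \<Rightarrow> bool" where
  "weight M w \<longleftrightarrow> w \<in> borel_measurable M \<and> (AE \<tau> in M. 0 < w \<tau> \<and> w \<tau> < \<infinity>)"


section \<open>Extended powers and logarithms\<close>

text \<open>Only used with positive exponents.\<close>

definition epowr :: "ennreal \<Rightarrow> real \<Rightarrow> ennreal" where
  "epowr x a = (if x = \<infinity> then \<infinity> else ennreal (enn2real x powr a))"

definition elog :: "ennreal \<Rightarrow> ereal" where
  "elog x = (if x = 0 then -\<infinity> else if x = \<infinity> then \<infinity> else ereal (ln (enn2real x)))"


section \<open>Nakano spaces\<close>

text \<open>Modular and norms depend on a function only through its modulus. They are therefore
  defined on functions with values in \<open>[0, \<infinity>]\<close>, which also covers products and quotients of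
  indicators and weights; for complex-valued \<open>f\<close> use \<open>\<lambda>\<tau>. ennreal (cmod (f \<tau>))\<close>.
  A norm is infinite exactly for functions outside the space.\<close>

definition nakano_modular :: "complex measure \<Rightarrow> (complex \<Rightarrow> real) \<Rightarrow> (complex \<Rightarrow> ennreal) \<Rightarrow> ennreal" where
  "nakano_modular M p f = (\<integral>\<^sup>+ \<tau>. epowr (f \<tau>) (p \<tau>) \<partial>M)"

definition nakano_norm :: "complex measure \<Rightarrow> (complex \<Rightarrow> real) \<Rightarrow> (complex \<Rightarrow> ennreal) \<Rightarrow> ennreal" where
  "nakano_norm M p f =
     (INF l \<in> {l :: real. 0 < l \<and> nakano_modular M p (\<lambda>\<tau>. f \<tau> / ennreal l) \<le> 1}. ennreal l)"

definition nakano_unit_ball :: "complex measure \<Rightarrow> (complex \<Rightarrow> real) \<Rightarrow> (complex \<Rightarrow> complex) set" where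
  "nakano_unit_ball M p =
     {f. f \<in> borel_measurable M \<and> nakano_norm M p (\<lambda>\<tau>. ennreal (cmod (f \<tau>))) \<le> 1}"

definition associate_norm :: "complex measure \<Rightarrow> (complex \<Rightarrow> real) \<Rightarrow> (complex \<Rightarrow> ennreal) \<Rightarrow> ennreal" where
  "associate_norm M p h =
     (SUP f \<in> nakano_unit_ball M p. \<integral>\<^sup>+ \<tau>. ennreal (cmod (f \<tau>)) * h \<tau> \<partial>M)"

text \<open>At \<open>\<tau> = t\<close> the estimate reads \<open>0 \<le> A / 0 = 0\<close> and holds, as intended.\<close>

definition exponent_class :: "complex measure \<Rightarrow> complex \<Rightarrow> (complex \<Rightarrow> real) set" where
  "exponent_class M t =
     {p. continuous_on (space M) p \<and> (\<forall>\<tau>\<in>space M. 1 < p \<tau>) \<and>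
         (\<exists>A>0. \<forall>\<tau>\<in>portion M t (1/2). \<bar>p \<tau> - p t\<bar> \<le> A / (- ln (cmod (\<tau> - t))))}"

definition A_class :: "complex measure \<Rightarrow> (complex \<Rightarrow> real) \<Rightarrow> complex \<Rightarrow> (complex \<Rightarrow> ennreal) set" where
  "A_class M p t =
     {w. weight M w \<and>
         (SUP R\<in>{0<..}. nakano_norm M p (\<lambda>\<tau>. w \<tau> * indicator (portion M t R) \<tau>)
            * associate_norm M p (\<lambda>\<tau>. indicator (portion M t R) \<tau> / w \<tau>) / ennreal R) < \<infinity>}"


section \<open>Bounded mean oscillation at a point\<close>

definition mean :: "complex measure \<Rightarrow> complex \<Rightarrow> (complex \<Rightarrow> ereal) \<Rightarrow> real \<Rightarrow> real" where
  "mean M t f R =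
     (LINT \<tau>:portion M t R|M. real_of_ereal (f \<tau>)) / measure M (portion M t R)"

definition BMO :: "complex measure \<Rightarrow> complex \<Rightarrow> (complex \<Rightarrow> ereal) set" where
  "BMO M t =
     {f. f \<in> borel_measurable M \<and> (AE \<tau> in M. \<bar>f \<tau>\<bar> < \<infinity>) \<and>
         integrable M (\<lambda>\<tau>. real_of_ereal (f \<tau>)) \<and>
         (SUP R\<in>{0<..}. (\<integral>\<^sup>+ \<tau> \<in> portion M t R. e2ennreal \<bar>f \<tau> - ereal (mean M t f R)\<bar> \<partial>M)
            / emeasure M (portion M t R)) < \<infinity>}"


section \<open>Indices\<close>

definition lower_index :: "(real \<Rightarrow> ennreal) \<Rightarrow> ereal" where
  "lower_index \<Phi> = (SUP x\<in>{0<..<1}. elog (\<Phi> x) / ereal (ln x))"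

definition upper_index :: "(real \<Rightarrow> ennreal) \<Rightarrow> ereal" where
  "upper_index \<Phi> = (INF x\<in>{1<..}. elog (\<Phi> x) / ereal (ln x))"

definition G_fun :: "complex measure \<Rightarrow> (complex \<Rightarrow> real) \<Rightarrow> complex \<Rightarrow> (complex \<Rightarrow> ennreal)
    \<Rightarrow> real \<Rightarrow> real \<Rightarrow> ennreal" where
  "G_fun M p t w R1 R2 =
     nakano_norm M p (\<lambda>\<tau>. w \<tau> * indicator (annulus M t R1) \<tau>)
       * associate_norm M p (\<lambda>\<tau>. indicator (annulus M t R2) \<tau> / w \<tau>)
       / emeasure M (annulus M t R2)"

definition Q_fun :: "complex measure \<Rightarrow> (complex \<Rightarrow> real) \<Rightarrow> complex \<Rightarrow> (complex \<Rightarrow> ennreal)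
    \<Rightarrow> real \<Rightarrow> ennreal" where
  "Q_fun M p t w x =
     (if x \<le> 1 then SUP R\<in>{0<..max_dist M t}. G_fun M p t w (x * R) R
      else SUP R\<in>{0<..max_dist M t}. G_fun M p t w R (inverse x * R))"

definition H_fun :: "complex measure \<Rightarrow> complex \<Rightarrow> (complex \<Rightarrow> ennreal) \<Rightarrow> real \<Rightarrow> real \<Rightarrow> ennreal" where
  "H_fun M t w R1 R2 =
     ennreal (exp (mean M t (\<lambda>\<tau>. elog (w \<tau>)) R1) / exp (mean M t (\<lambda>\<tau>. elog (w \<tau>)) R2))"

definition V_fun :: "complex measure \<Rightarrow> complex \<Rightarrow> (complex \<Rightarrow> ennreal) \<Rightarrow> real \<Rightarrow> ennreal" where
  "V_fun M t w x =
     (if x \<le> 1 then SUP R\<in>{0<..max_dist M t}. H_fun M t w (x * R) R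
      else SUP R\<in>{0<..max_dist M t}. H_fun M t w R (inverse x * R))"

end

theory Submission
  imports Defs
begin

text \<open>
  Write \<open>a = 1 / p t\<close>. By the logarithmic continuity of \<open>p\<close> at \<open>t\<close>, \<open>R powr p \<tau>\<close> and \<open>R powr p t\<close>
  are comparable on \<open>\<Gamma>(t,R)\<close>, so the indicator of \<open>\<Gamma>(t,R)\<close> has norm of order at most \<open>R powr a\<close> in \<open>X\<close>
  and \<open>R powr (1 - a)\<close> in \<open>X'\<close>. Hoelder's inequality then turns the condition on \<open>w\<close> into an \<open>A\<^sub>2\<close>-type
  bound on the product of the integrals of \<open>w\<close> and \<open>1/w\<close> over \<open>\<Gamma>(t,R)\<close>, and Jensen's inequality gives
  bounded mean oscillation of \<open>log w\<close>. The same two inequalities on the annulus \<open>\<Delta>(t,R)\<close>, whose length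
  is comparable to \<open>R\<close>, determine the norms of \<open>w\<close> and \<open>1/w\<close> there up to constant factors, whence
  \<open>Q\<^sub>t w(x)\<close> is comparable to \<open>x powr a * V\<^sub>t w(x)\<close>. Both functions are submultiplicative on \<open>(0,1)\<close> and
  on \<open>(1,\<infinity>)\<close>, so evaluating at \<open>x^n\<close> and letting \<open>n\<close> tend to infinity removes the constants.
\<close>

section \<open>Rectifiable curves and their length measure\<close>

text \<open>The \<open>A\<close> condition bounds only the product of the norms of \<open>w\<close>
  and \<open>1/w\<close> from above; Jensen bounds each factor from below, and together this pins
  both. Bounded mean oscillation then lets the mean of \<open>log w\<close> over the annulus be
  exchanged for the mean over the portion, because the annulus fills a fixed fraction of it. That
  fraction is geometric: for \<open>R\<close> up to the maximal distance, the curve has to leave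
  \<open>t\<close> as far as distance \<open>R\<close>, so some arc lies in the annulus while its
  distance from \<open>t\<close> changes by \<open>R/4\<close>. Turning this chord into length needs
  the Stieltjes measure of half-open intervals, hence right continuity of arc length. Since
  \<open>p\<close> varies, norms of indicators are not computed but tested: a trial value in the
  modular for \<open>X\<close>, a pointwise inequality of Young type for \<open>X'\<close>. Norms
  take values in [0, infinity], so each factor is shown to be nonzero before the bound on the
  product makes both finite. Submultiplicativity is proved on each side of \<open>1\<close>
  separately, because an intermediate radius must not exceed the maximal distance.\<close>

lemma path_length_on_upper:
  assumes "mono_on {..n} x" "x ` {..n} \<subseteq> {a..b}"
  shows "(\<Sum>i<n. ennreal (dist (g (x i)) (g (x (Suc i))))) \<le> path_length_on g a b"
  unfolding path_length_on_def by (rule SUP_upper2[of "(n, x)"]) (use assms in auto)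

lemma path_length_on_least:
  assumes "\<And>n x. mono_on {..n} x \<Longrightarrow> x ` {..n} \<subseteq> {a..b} \<Longrightarrow>
    (\<Sum>i<n. ennreal (dist (g (x i)) (g (x (Suc i))))) \<le> K"
  shows "path_length_on g a b \<le> K"
  unfolding path_length_on_def by (rule SUP_least) (use assms in auto)

lemma path_length_on_mono:
  assumes "a' \<le> a" "b \<le> b'"
  shows "path_length_on g a b \<le> path_length_on g a' b'"
  by (rule path_length_on_least, rule path_length_on_upper) (use assms in fastforce)+

lemma dist_le_path_length_on:
  assumes "a \<le> b"
  shows "ennreal (dist (g a) (g b)) \<le> path_length_on g a b"
proof -
  define x where "x i = (if i = (0::nat) then a else b)" for i
  have "(\<Sum>i<1. ennreal (dist (g (x i)) (g (x (Suc i))))) \<le> path_length_on g a b"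
    by (rule path_length_on_upper) (use assms in \<open>auto simp: x_def monotone_on_def\<close>)
  then show ?thesis by (simp add: x_def)
qed

text \<open>Two inscribed chains concatenate to a chain for the whole interval, and the chord
  joining them only adds length. The suprema are then taken one at a time, which uses that both
  families of chains are nonempty.\<close>

lemma path_length_on_superadditive:
  assumes "a \<le> b" "b \<le> c"
  shows "path_length_on g a b + path_length_on g b c \<le> path_length_on g a c"
proof -
  let ?S = "\<lambda>n x. \<Sum>i<n. ennreal (dist (g (x i)) (g (x (Suc i))))"
  let ?P = "\<lambda>a b. {(n :: nat, x :: nat \<Rightarrow> real). mono_on {..n} x \<and> x ` {..n} \<subseteq> {a..b}}"
  have ne: "?P a b \<noteq> {}" if "a \<le> b" for a b :: real
  proof -
    have "(0, \<lambda>_. a) \<in> ?P a b" using that by (auto simp: monotone_on_def)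
    then show ?thesis by blast
  qed
  have *: "?S n x + ?S m y \<le> path_length_on g a c"
    if x: "mono_on {..n} x" "x ` {..n} \<subseteq> {a..b}" and y: "mono_on {..m} y" "y ` {..m} \<subseteq> {b..c}"
    for n m :: nat and x y :: "nat \<Rightarrow> real"
  proof -
    \<comment> \<open>\<open>y 0\<close> follows \<open>x n\<close> as a new vertex even when the
      two coincide. Segment \<open>n\<close> is therefore the joining chord, dropped below by
      \<open>sum_mono2\<close>, and the chain has \<open>n + Suc m\<close> segments.\<close>
    define z where "z i = (if i \<le> n then x i else y (i - Suc n))" for i
    have xb: "a \<le> x i \<and> x i \<le> b" if "i \<le> n" for i using x(2) that by fastforce
    have yb: "b \<le> y i \<and> y i \<le> c" if "i \<le> m" for i using y(2) that by fastforce
    have "mono_on {..n + Suc m} z"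
    proof (rule monotone_onI)
      fix i j assume ij: "i \<in> {..n + Suc m}" "j \<in> {..n + Suc m}" "i \<le> j"
      consider "j \<le> n" | "i \<le> n" "n < j" | "n < i" using ij by linarith
      then show "z i \<le> z j"
      proof cases
        case 1 then show ?thesis using ij x(1) by (auto simp: z_def monotone_on_def)
      next
        case 2
        then have "x i \<le> b" "b \<le> y (j - Suc n)" using xb yb ij by auto
        then show ?thesis using 2 by (simp add: z_def)
      next
        case 3
        then have "y (i - Suc n) \<le> y (j - Suc n)"
          by (intro monotone_onD[OF y(1)]) (use ij in auto)
        then show ?thesis using 3 ij by (simp add: z_def)
      qed
    qed
    moreover have "z ` {..n + Suc m} \<subseteq> {a..c}"
    proof
      fix u assume "u \<in> z ` {..n + Suc m}"
      then obtain i where i: "i \<le> n + Suc m" "u = z i" by auto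
      show "u \<in> {a..c}"
      proof (cases "i \<le> n")
        case True then show ?thesis using xb[OF True] i assms by (simp add: z_def)
      next
        case False
        then have "i - Suc n \<le> m" using i by simp
        then show ?thesis using yb[of "i - Suc n"] i assms False by (simp add: z_def)
      qed
    qed
    ultimately have "?S (n + Suc m) z \<le> path_length_on g a c" by (rule path_length_on_upper)
    moreover have "?S n x + ?S m y \<le> ?S (n + Suc m) z"
    proof -
      have inj: "inj_on (\<lambda>i. i + Suc n) {..<m}" by (auto intro: inj_onI)
      have "?S n x = ?S n z" by (rule sum.cong) (auto simp: z_def)
      moreover have "?S m y = (\<Sum>i\<in>(\<lambda>i. i + Suc n) ` {..<m}. ennreal (dist (g (z i)) (g (z (Suc i)))))"
        by (subst sum.reindex[OF inj], rule sum.cong) (auto simp: z_def)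
      moreover have "(\<Sum>i<n. ennreal (dist (g (z i)) (g (z (Suc i))))) +
         (\<Sum>i\<in>(\<lambda>i. i + Suc n) ` {..<m}. ennreal (dist (g (z i)) (g (z (Suc i))))) =
         (\<Sum>i\<in>{..<n} \<union> (\<lambda>i. i + Suc n) ` {..<m}. ennreal (dist (g (z i)) (g (z (Suc i)))))"
        by (rule sum.union_disjoint[symmetric]) auto
      moreover have "\<dots> \<le> ?S (n + Suc m) z"
        by (rule sum_mono2) auto
      ultimately show ?thesis by simp
    qed
    ultimately show ?thesis by (rule order_trans[rotated])
  qed
  have "path_length_on g a b + path_length_on g b c =
    (SUP (n, x)\<in>?P a b. ?S n x + path_length_on g b c)"
    unfolding path_length_on_def[of g a b] 
    by (subst ennreal_SUP_add_left[symmetric, OF ne[OF assms(1)]]) (simp add: case_prod_beta)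
  also have "\<dots> \<le> path_length_on g a c"
  proof (rule SUP_least, clarify)
    fix n :: nat and x :: "nat \<Rightarrow> real"
    assume x: "mono_on {..n} x" "x ` {..n} \<subseteq> {a..b}"
    have "?S n x + path_length_on g b c = (SUP (m, y)\<in>?P b c. ?S n x + ?S m y)"
      unfolding path_length_on_def[of g b c]
      by (subst ennreal_SUP_add_right[OF ne[OF assms(2)]]) (simp add: case_prod_beta)
    also have "\<dots> \<le> path_length_on g a c"
      by (rule SUP_least) (use * x in auto)
    finally show "?S n x + path_length_on g b c \<le> path_length_on g a c" .
  qed
  finally show ?thesis .
qed

section \<open>Right continuity of the arc length\<close>

lemma ennreal_le_add3:
  assumes "d \<le> a + (b + c)" "0 \<le> a" "0 \<le> b" "0 \<le> c"
  shows "ennreal d \<le> ennreal a + (ennreal b + ennreal c)"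
  using assms by (simp flip: ennreal_plus)

text \<open>Clipping cuts the step from \<open>u\<close> to \<open>v\<close> at \<open>c\<close>. If
  \<open>c\<close> lies between them this is the triangle inequality through \<open>g c\<close>;
  otherwise one of the two clipped steps is constant.\<close>

lemma dist_le_clip:
  fixes g :: "real \<Rightarrow> 'a::metric_space"
  assumes "u \<le> v"
  shows "dist (g u) (g v) \<le> dist (g (min u c)) (g (min v c)) + dist (g (max u c)) (g (max v c))"
proof (cases "u \<le> c \<and> c \<le> v")
  case True
  then show ?thesis using dist_triangle[of "g u" "g v" "g c"] by (simp add: min_def max_def)
next
  case False
  then show ?thesis using assms by (auto simp: min_def max_def)
qed

text \<open>A monotone chain with two values jumps at most once, so all but one of the distances
  vanish.\<close>

lemma sum_dist_two_valued:
  fixes g :: "real \<Rightarrow> 'a::metric_space"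
  assumes "mono_on {..n} z" "z ` {..n} \<subseteq> {c, d}" "c \<le> d"
  shows "(\<Sum>i<n. dist (g (z i)) (g (z (Suc i)))) \<le> dist (g c) (g (z n))"
  using assms
proof (induction n)
  case (Suc n)
  have *: "(\<Sum>i<n. dist (g (z i)) (g (z (Suc i)))) \<le> dist (g c) (g (z n))"
    by (rule Suc.IH[OF monotone_on_subset[OF Suc.prems(1)]
          order_trans[OF image_mono Suc.prems(2)] Suc.prems(3)]) auto
  have le: "z n \<le> z (Suc n)" using Suc.prems(1) by (auto simp: monotone_on_def)
  have mem: "z n \<in> {c, d}" "z (Suc n) \<in> {c, d}"
    by (rule subsetD[OF Suc.prems(2)], simp)+
  show ?case
  proof (cases "z n = c")
    case True then show ?thesis using * by simp
  next
    case False
    then have "z (Suc n) = z n" using le mem \<open>c \<le> d\<close> by auto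
    then show ?thesis using * by simp
  qed
qed simp

text \<open>A chain that is optimal up to \<open>e / 2\<close> is clipped to \<open>{a..c}\<close>,
  \<open>{c..d}\<close> and \<open>{d..b}\<close>. If no vertex lies strictly between
  \<open>c\<close> and \<open>d\<close>, the middle piece is a single chord, which continuity makes
  at most \<open>e / 2\<close>. Comparing with superadditivity at \<open>d\<close> and cancelling
  the finite length of \<open>{d..b}\<close> leaves the claim.\<close>

lemma path_length_on_right_continuous:
  fixes g :: "real \<Rightarrow> complex"
  assumes cont: "continuous_on {a..b} g" and fin: "path_length_on g a b < \<infinity>"
    and c: "a \<le> c" "c < b" and e: "0 < e"
  obtains d where "c < d" "d \<le> b" "path_length_on g a d \<le> path_length_on g a c + ennreal e"
proof -
  let ?S = "\<lambda>n x. \<Sum>i<n. ennreal (dist (g (x i)) (g (x (Suc i))))"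
  obtain n x where x: "mono_on {..n} x" "x ` {..n} \<subseteq> {a..b}"
    and big: "path_length_on g a b \<le> ?S n x + ennreal (e / 2)"
  proof -
    let ?P = "{(n :: nat, x :: nat \<Rightarrow> real). mono_on {..n} x \<and> x ` {..n} \<subseteq> {a..b}}"
    have "(0, \<lambda>_. a) \<in> ?P" using c by (auto simp: monotone_on_def)
    then have ne: "?P \<noteq> {}" by blast
    have "0 < e / 2" "path_length_on g a b \<noteq> \<infinity>" using e fin by simp_all
    from SUP_approx_ennreal[OF this(1) ne path_length_on_def[of g a b] this(2)]
    obtain n x where "mono_on {..n} x" "x ` {..n} \<subseteq> {a..b}"
        "path_length_on g a b < ?S n x + ennreal (e / 2)"
      by (elim bexE) (simp only: mem_Collect_eq split_beta, blast)
    then show ?thesis by (rule that[OF _ _ less_imp_le])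
  qed
  have "c \<in> {a..b}" "0 < e / 2" using c e by auto
  then obtain r where r: "r > 0" "\<And>y. y \<in> {a..b} \<Longrightarrow> dist y c < r \<Longrightarrow> dist (g y) (g c) < e / 2"
    using cont unfolding continuous_on_iff by blast
  \<comment> \<open>The minimum of this finite set respects the end of the interval and the radius
    of continuity, and it passes over no vertex of the chain.\<close>
  define T where "T = insert b (insert (c + r / 2) (x ` {..n} \<inter> {c<..}))"
  define d where "d = Min T"
  have T: "finite T" "T \<noteq> {}" by (auto simp: T_def)
  have d: "d \<le> b" "d \<le> c + r / 2"
    unfolding d_def by (rule Min_le[OF T(1)], simp add: T_def)+
  moreover have "c < d"
    using T c r by (simp add: d_def T_def)
  ultimately have d: "c < d" "d \<le> b" "d \<le> c + r / 2" by auto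
  have xd: "x i \<le> c \<or> d \<le> x i" if "i \<le> n" for i
  proof (cases "x i \<le> c")
    case False
    then have "x i \<in> T" using that by (simp add: T_def)
    then show ?thesis unfolding d_def using Min_le[OF T(1)] by blast
  qed simp
  have gd: "dist (g c) (g d) < e / 2"
    using r(2)[of d] d c r(1) by (auto simp: dist_real_def dist_commute)
  have xb: "a \<le> x i \<and> x i \<le> b" if "i \<le> n" for i using x(2) that by fastforce
  have xm: "x i \<le> x (Suc i)" if "i < n" for i using x(1) that by (auto simp: monotone_on_def)
  have xm': "x i \<le> x j" if "i \<le> j" "j \<le> n" for i j using x(1) that by (auto simp: monotone_on_def)
  let ?x1 = "\<lambda>i. min (x i) c" and ?x2 = "\<lambda>i. min (max (x i) c) d" and ?x3 = "\<lambda>i. max (max (x i) c) d"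
  have "?S n x \<le> (\<Sum>i<n. ennreal (dist (g (?x1 i)) (g (?x1 (Suc i)))) +
      (ennreal (dist (g (?x2 i)) (g (?x2 (Suc i)))) + ennreal (dist (g (?x3 i)) (g (?x3 (Suc i))))))"
  proof (rule sum_mono)
    fix i assume "i \<in> {..<n}"
    then have "x i \<le> x (Suc i)" using xm by simp
    then have "max (x i) c \<le> max (x (Suc i)) c" by (rule max.mono) simp
    note * = dist_le_clip[OF this, of g d] and ** = dist_le_clip[OF \<open>x i \<le> x (Suc i)\<close>, of g c]
    show "ennreal (dist (g (x i)) (g (x (Suc i)))) \<le> ennreal (dist (g (?x1 i)) (g (?x1 (Suc i)))) +
      (ennreal (dist (g (?x2 i)) (g (?x2 (Suc i)))) + ennreal (dist (g (?x3 i)) (g (?x3 (Suc i)))))"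
      by (rule ennreal_le_add3[OF order_trans[OF ** add_left_mono[OF *]]]) (rule zero_le_dist)+
  qed
  also have "\<dots> = ?S n ?x1 + (?S n ?x2 + ?S n ?x3)" by (simp only: sum.distrib)
  also have "\<dots> \<le> path_length_on g a c + (ennreal (e / 2) + path_length_on g d b)"
  proof (intro add_mono)
    show "?S n ?x1 \<le> path_length_on g a c"
    proof (rule path_length_on_upper)
      show "mono_on {..n} ?x1" using xm' by (intro monotone_onI min.mono) auto
      show "?x1 ` {..n} \<subseteq> {a..c}" using xb c by auto
    qed
    show "?S n ?x3 \<le> path_length_on g d b"
    proof (rule path_length_on_upper)
      show "mono_on {..n} ?x3" using xm' by (intro monotone_onI max.mono) auto
      show "?x3 ` {..n} \<subseteq> {d..b}" using xb c d by auto
    qed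
    have x2: "?x2 i \<in> {c, d}" if "i \<le> n" for i
      using xd[OF that] d(1) by (auto simp: min_def max_def)
    then have sub: "?x2 ` {..n} \<subseteq> {c, d}" by blast
    have "(\<Sum>i<n. dist (g (?x2 i)) (g (?x2 (Suc i)))) \<le> dist (g c) (g (?x2 n))"
    proof (rule sum_dist_two_valued[OF _ sub])
      show "mono_on {..n} ?x2" using xm' by (intro monotone_onI min.mono max.mono) auto
    qed (use d in simp)
    also have "\<dots> \<le> e / 2" using x2[of n] gd e by auto
    finally have "ennreal (\<Sum>i<n. dist (g (?x2 i)) (g (?x2 (Suc i)))) \<le> ennreal (e / 2)"
      by (rule ennreal_leI)
    then show "?S n ?x2 \<le> ennreal (e / 2)" by (subst sum_ennreal) simp_all
  qed
  finally have "?S n x \<le> path_length_on g a c + (ennreal (e / 2) + path_length_on g d b)" .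
  then have le: "path_length_on g a b \<le> path_length_on g a c + (ennreal (e / 2) + path_length_on g d b) + ennreal (e / 2)"
    using big by (meson add_right_mono order_trans)
  have "ennreal (e / 2) + ennreal (e / 2) = ennreal e"
    using e by (simp flip: ennreal_plus)
  then have eq: "path_length_on g a c + (ennreal (e / 2) + path_length_on g d b) + ennreal (e / 2)
     = (path_length_on g a c + ennreal e) + path_length_on g d b"
    by (metis add.assoc add.commute)
  have "path_length_on g a d + path_length_on g d b \<le> path_length_on g a b"
    using c d by (intro path_length_on_superadditive) auto
  with le have "path_length_on g d b + path_length_on g a d \<le> path_length_on g d b + (path_length_on g a c + ennreal e)"
    unfolding eq by (metis add.commute order_trans)
  moreover have "path_length_on g d b \<noteq> \<infinity>"
    using path_length_on_mono[of a d b b g] c d fin by (auto simp: less_top)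
  ultimately have "path_length_on g a d \<le> path_length_on g a c + ennreal e"
    by (metis ennreal_add_left_cancel_le infinity_ennreal_def)
  then show thesis using that d by blast
qed

text \<open>This is the integrator inside \<open>arclength_measure\<close>, named so that its
  monotonicity and right continuity on the whole line can be stated.\<close>

definition arclength_fun :: "(real \<Rightarrow> complex) \<Rightarrow> real \<Rightarrow> real" where
  "arclength_fun g s = enn2real (path_length_on g 0 (max 0 (min 1 s)))"

text \<open>Take \<open>b\<close> as the first point with value \<open>q\<close> and
  \<open>a\<close> as the last point before \<open>b\<close> with value \<open>p\<close>. A value
  outside \<open>{p..q}\<close> in between would, by the intermediate value theorem, produce a later
  \<open>p\<close> or an earlier \<open>q\<close>.\<close>

lemma crossing_subinterval:
  fixes h :: "real \<Rightarrow> real"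
  assumes h: "continuous_on {u..v} h" and "u \<le> v" "h u \<le> p" "p \<le> q" "q \<le> h v"
  obtains a b where "u \<le> a" "a \<le> b" "b \<le> v" "h ` {a..b} \<subseteq> {p..q}" "h a = p" "h b = q"
proof -
  have cpt: "compact {s\<in>{u'..v'}. h s = y}" if "u \<le> u'" "v' \<le> v" for u' v' y
  proof -
    have "closed {s\<in>{u'..v'}. h s = y}"
      using continuous_closed_preimage_constant[OF continuous_on_subset[OF h], of "{u'..v'}"] that by auto
    moreover have "bounded {s\<in>{u'..v'}. h s = y}"
      by (rule bounded_subset[of "{u'..v'}"]) auto
    ultimately show ?thesis by (simp add: compact_eq_bounded_closed)
  qed
  have "\<exists>s\<ge>u. s \<le> v \<and> h s = q"
    by (rule IVT') (use assms in auto)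
  then have ne: "{s\<in>{u..v}. h s = q} \<noteq> {}" by auto
  from compact_attains_inf[OF cpt[OF order_refl order_refl] ne] obtain b where b: "b \<in> {s\<in>{u..v}. h s = q}" "\<And>s. s \<in> {s\<in>{u..v}. h s = q} \<Longrightarrow> b \<le> s"
    by blast
  have "\<exists>s\<ge>u. s \<le> b \<and> h s = p"
    by (rule IVT') (use assms(2-5) b(1) continuous_on_subset[OF h, of "{u..b}"] in auto)
  then have ne': "{s\<in>{u..b}. h s = p} \<noteq> {}" by auto
  have "b \<le> v" using b by simp
  from compact_attains_sup[OF cpt[OF order_refl this] ne'] obtain a where a: "a \<in> {s\<in>{u..b}. h s = p}" "\<And>s. s \<in> {s\<in>{u..b}. h s = p} \<Longrightarrow> s \<le> a"
    by blast
  have "p \<le> h s \<and> h s \<le> q" if s: "s \<in> {a..b}" for s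
  proof (intro conjI; rule ccontr)
    assume *: "\<not> p \<le> h s"
    have "\<exists>x\<ge>s. x \<le> b \<and> h x = p"
    proof (rule IVT')
      show "h s \<le> p" using * by simp
      show "p \<le> h b" using b(1) assms(4) by simp
      show "s \<le> b" using s by simp
      show "continuous_on {s..b} h"
        by (rule continuous_on_subset[OF h]) (use s a(1) b(1) in auto)
    qed
    then obtain x where x: "s \<le> x" "x \<le> b" "h x = p" by blast
    have "x \<le> a" by (rule a(2)) (use x s a(1) in auto)
    then have "s = a" using s x by auto
    then show False using * a(1) assms(4) by simp
  next
    assume *: "\<not> h s \<le> q"
    have "\<exists>x\<ge>u. x \<le> s \<and> h x = q"
    proof (rule IVT')
      show "h u \<le> q" using assms(3,4) by simp
      show "q \<le> h s" using * by simp
      show "u \<le> s" using s a(1) by simp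
      show "continuous_on {u..s} h"
        by (rule continuous_on_subset[OF h]) (use s b(1) in auto)
    qed
    then obtain x where x: "u \<le> x" "x \<le> s" "h x = q" by blast
    have "b \<le> x" by (rule b(2)) (use x s b(1) in auto)
    then have "s = b" using s x by auto
    then show False using * b(1) by simp
  qed
  then show thesis using a(1) b(1) by (intro that[of a b]) auto
qed

section \<open>Lower bounds for length on a rectifiable Jordan curve\<close>

context
  fixes g :: "real \<Rightarrow> complex"
  assumes rect: "rectifiable_jordan_curve g"
begin

lemma rectifiable_continuous: "continuous_on {0..1} g"
  using rect by (auto simp: rectifiable_jordan_curve_def simple_path_def path_def)

lemma path_length_on_finite:
  assumes "0 \<le> a" "b \<le> 1"
  shows "path_length_on g a b < \<infinity>"
  using path_length_on_mono[OF assms, of g] rect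
  by (auto simp: rectifiable_jordan_curve_def intro: le_less_trans)

lemma ennreal_arclength_fun:
  "ennreal (arclength_fun g s) = path_length_on g 0 (max 0 (min 1 s))"
  unfolding arclength_fun_def
  using path_length_on_finite[of 0 "max 0 (min 1 s)"] by (intro ennreal_enn2real) auto

lemma arclength_fun_nonneg: "0 \<le> arclength_fun g s"
  by (simp add: arclength_fun_def)

lemma arclength_fun_mono:
  assumes "x \<le> y"
  shows "arclength_fun g x \<le> arclength_fun g y"
proof -
  have "ennreal (arclength_fun g x) \<le> ennreal (arclength_fun g y)"
    unfolding ennreal_arclength_fun using assms by (intro path_length_on_mono) auto
  then show ?thesis by (simp add: arclength_fun_nonneg)
qed

lemma dist_le_arclength_fun:
  assumes "0 \<le> a" "a \<le> b" "b \<le> 1"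
  shows "dist (g a) (g b) \<le> arclength_fun g b - arclength_fun g a"
proof -
  have "ennreal (arclength_fun g a + dist (g a) (g b)) \<le> path_length_on g 0 a + path_length_on g a b"
    using assms dist_le_path_length_on[of a b g] ennreal_arclength_fun[of a]
    by (simp add: ennreal_plus arclength_fun_nonneg add_mono)
  also have "\<dots> \<le> path_length_on g 0 b"
    using assms by (intro path_length_on_superadditive) auto
  also have "\<dots> = ennreal (arclength_fun g b)"
    using assms by (simp add: ennreal_arclength_fun)
  finally show ?thesis
    using arclength_fun_nonneg by (subst (asm) ennreal_le_iff) auto
qed

lemma arclength_fun_right_continuous: "continuous (at_right a) (arclength_fun g)"
proof (subst continuous_at_right_real_increasing[OF arclength_fun_mono], assumption, intro allI impI)
  fix e :: real assume e: "0 < e"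
  consider "a < 0" | "1 \<le> a" | "0 \<le> a" "a < 1" by linarith
  then show "\<exists>d>0. arclength_fun g (a + d) - arclength_fun g a < e"
  proof cases
    case 1
    then show ?thesis using e by (intro exI[of _ "-a"]) (simp add: arclength_fun_def)
  next
    case 2
    then show ?thesis using e by (intro exI[of _ 1]) (simp add: arclength_fun_def)
  next
    case 3
    obtain b where b: "a < b" "b \<le> 1"
      "path_length_on g 0 b \<le> path_length_on g 0 a + ennreal (e / 2)"
      using path_length_on_right_continuous[OF rectifiable_continuous _ 3, of "e / 2"]
        path_length_on_finite[of 0 1] e by auto
    then have "ennreal (arclength_fun g b) \<le> ennreal (arclength_fun g a + e / 2)"
      using 3 e by (simp add: ennreal_arclength_fun ennreal_plus arclength_fun_nonneg)
    then have "arclength_fun g b \<le> arclength_fun g a + e / 2"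
      using e arclength_fun_nonneg[of a] by (subst (asm) ennreal_le_iff) auto
    then show ?thesis using b e by (intro exI[of _ "b - a"]) auto
  qed
qed

lemma sets_arclength_measure:
  assumes "S \<in> sets (restrict_space borel (path_image g))"
  shows "S \<in> sets (arclength_measure g)"
  unfolding arclength_measure_def by (rule sets_completionI_sets) (use assms in simp)

text \<open>The chord is at most the increment of arc length, which right continuity identifies with
  the Stieltjes measure of \<open>{a<..b}\<close>. This interval is contained in the preimage of
  \<open>S\<close>, and completion does not change the measure of a Borel set.\<close>

lemma emeasure_arclength_measure_ge:
  assumes S: "S \<in> sets (restrict_space borel (path_image g))"
    and ab: "0 \<le> a" "a \<le> b" "b \<le> 1" and sub: "g ` {a<..b} \<subseteq> S"
  shows "ennreal (dist (g a) (g b)) \<le> emeasure (arclength_measure g) S"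
proof -
  let ?I = "interval_measure (arclength_fun g)"
  let ?R = "restrict_space ?I {0..1}"
  have "g \<in> borel_measurable (restrict_space borel {0..1})"
    by (rule borel_measurable_continuous_on_restrict[OF rectifiable_continuous])
  moreover have "sets ?R = sets (restrict_space borel {0..1})"
    by (rule sets_restrict_space_cong) simp
  ultimately have "g \<in> borel_measurable ?R"
    by (simp cong: measurable_cong_sets)
  moreover have "g \<in> space ?R \<rightarrow> path_image g"
    by (simp add: space_restrict_space path_image_def)
  ultimately have g: "g \<in> measurable ?R (restrict_space borel (path_image g))"
    by (intro measurable_restrict_space2)
  have "ennreal (dist (g a) (g b)) \<le> ennreal (arclength_fun g b - arclength_fun g a)"
    using dist_le_arclength_fun[OF ab] by (rule ennreal_leI)
  also have "\<dots> = emeasure ?I {a<..b}"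
    using emeasure_interval_measure_Ioc[of a b "arclength_fun g"] ab arclength_fun_mono
      arclength_fun_right_continuous by simp
  also have "\<dots> = emeasure ?R {a<..b}"
    using ab by (subst emeasure_restrict_space) auto
  also have "\<dots> \<le> emeasure ?R (g -` S \<inter> space ?R)"
    by (rule emeasure_mono) (use measurable_sets[OF g S] sub ab in \<open>auto simp: space_restrict_space\<close>)
  also have "\<dots> = emeasure (distr ?R (restrict_space borel (path_image g)) g) S"
    by (rule emeasure_distr[OF g S, symmetric])
  also have "\<dots> = emeasure (arclength_measure g) S"
    unfolding arclength_measure_def arclength_fun_def[abs_def]
    using S by (simp add: main_part_sets)
  finally show ?thesis .
qed

lemma portion_sets_borel: "portion (arclength_measure g) t R \<in> sets (restrict_space borel (path_image g))"
proof -
  have "portion (arclength_measure g) t R = path_image g \<inter> ball t R"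
    by (auto simp: portion_def dist_norm norm_minus_commute)
  then show ?thesis
    unfolding sets_restrict_space by (rule image_eqI) simp
qed

lemma annulus_sets_borel: "annulus (arclength_measure g) t R \<in> sets (restrict_space borel (path_image g))"
  unfolding annulus_def by (intro sets.Diff portion_sets_borel)

lemma path_image_not_subset_singleton: "\<exists>\<tau>\<in>path_image g. \<tau> \<noteq> t"
proof -
  have "g (1/3) \<noteq> g (2/3)"
  proof
    assume "g (1/3) = g (2/3)"
    moreover have "loop_free g" using rect by (auto simp: rectifiable_jordan_curve_def simple_path_def)
    ultimately show False unfolding loop_free_def by (fastforce dest: bspec[of _ _ "1/3"])
  qed
  moreover have "g (1/3) \<in> path_image g" "g (2/3) \<in> path_image g" by (auto simp: path_image_def)
  ultimately show ?thesis by metis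
qed

lemma max_dist_attained:
  obtains \<tau> where "\<tau> \<in> path_image g" "cmod (\<tau> - t) = max_dist (arclength_measure g) t"
    "\<And>\<sigma>. \<sigma> \<in> path_image g \<Longrightarrow> cmod (\<sigma> - t) \<le> max_dist (arclength_measure g) t"
proof -
  have "compact (path_image g)" "path_image g \<noteq> {}"
    using rect by (auto simp: rectifiable_jordan_curve_def simple_path_def)
  then obtain \<tau> where \<tau>: "\<tau> \<in> path_image g" "\<And>\<sigma>. \<sigma> \<in> path_image g \<Longrightarrow> cmod (\<sigma> - t) \<le> cmod (\<tau> - t)"
  proof -
    have "continuous_on (path_image g) (\<lambda>\<tau>. cmod (\<tau> - t))" by (intro continuous_intros)
    from continuous_attains_sup[OF \<open>compact (path_image g)\<close> \<open>path_image g \<noteq> {}\<close> this]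
    show ?thesis using that by blast
  qed
  then have "max_dist (arclength_measure g) t = cmod (\<tau> - t)"
    unfolding max_dist_def space_arclength_measure by (intro cSup_eq_maximum) auto
  then show thesis using \<tau> by (intro that[of \<tau>]) simp_all
qed

lemma cmod_le_max_dist:
  assumes "\<tau> \<in> path_image g"
  shows "cmod (\<tau> - t) \<le> max_dist (arclength_measure g) t"
  by (rule max_dist_attained[of t]) (use assms in simp)

lemma max_dist_pos: "0 < max_dist (arclength_measure g) t"
proof -
  from path_image_not_subset_singleton[of t]
  obtain \<tau> where \<tau>: "\<tau> \<in> path_image g" "\<tau> \<noteq> t" by (rule bexE)
  have "0 < cmod (\<tau> - t)" using \<tau>(2) by simp
  also have "\<dots> \<le> max_dist (arclength_measure g) t" by (rule cmod_le_max_dist[OF \<tau>(1)])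
  finally show ?thesis .
qed

text \<open>The distance from \<open>t\<close> along the curve takes the value 0 and a value at
  least \<open>R\<close>, so on some parameter interval it stays in \<open>{R/2..3/4*R}\<close> and
  runs from one end to the other. The chord there is at least \<open>R/4\<close>. The bound
  \<open>3/4*R\<close> replaces \<open>R\<close> because points at distance exactly \<open>R\<close>
  are outside the annulus.\<close>

lemma emeasure_annulus_ge:
  assumes t: "t \<in> path_image g" and R: "0 < R" "R \<le> max_dist (arclength_measure g) t"
  shows "ennreal (R / 4) \<le> emeasure (arclength_measure g) (annulus (arclength_measure g) t R)"
proof -
  define h where "h s = cmod (g s - t)" for s
  have h: "continuous_on {0..1} h"
    unfolding h_def by (intro continuous_intros rectifiable_continuous)
  obtain \<tau> where \<tau>: "\<tau> \<in> path_image g" "cmod (\<tau> - t) = max_dist (arclength_measure g) t"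
    by (rule max_dist_attained[of t])
  obtain s1 where s1: "s1 \<in> {0..1}" "R \<le> h s1"
    using \<tau> R by (auto simp: path_image_def h_def)
  obtain s0 where s0: "s0 \<in> {0..1}" "h s0 = 0"
    using t by (auto simp: path_image_def h_def)
  have key: "\<exists>a b. 0 \<le> a \<and> a \<le> b \<and> b \<le> 1 \<and> h ` {a..b} \<subseteq> {R/2..3/4*R} \<and> \<bar>h a - h b\<bar> = R/4"
  proof (cases "s0 \<le> s1")
    case True
    obtain a b where "s0 \<le> a" "a \<le> b" "b \<le> s1" "h ` {a..b} \<subseteq> {R/2..3/4*R}" "h a = R/2" "h b = 3/4*R"
      by (rule crossing_subinterval[of s0 s1 h "R/2" "3/4*R"])
        (use True s0 s1 R continuous_on_subset[OF h, of "{s0..s1}"] in auto)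
    then show ?thesis using s0 s1 R by (intro exI[of _ a] exI[of _ b]) auto
  next
    case False
    \<comment> \<open>The far point precedes \<open>t\<close> in the parametrization, so the
      crossing is sought along the reversed parameter.\<close>
    have h': "continuous_on {- s0..- s1} (\<lambda>x. h (- x))"
      by (rule continuous_on_compose2[OF h]) (use s0 s1 in \<open>auto intro!: continuous_intros\<close>)
    obtain a b where ab: "- s0 \<le> a" "a \<le> b" "b \<le> - s1" "(\<lambda>x. h (- x)) ` {a..b} \<subseteq> {R/2..3/4*R}"
      "h (- a) = R/2" "h (- b) = 3/4*R"
      by (rule crossing_subinterval[OF h', of "R/2" "3/4*R"]) (use False s0 s1 R in auto)
    have "h s \<in> {R/2..3/4*R}" if "s \<in> {- b..- a}" for s
    proof -
      have "(\<lambda>x. h (- x)) (- s) \<in> {R/2..3/4*R}"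
        by (rule subsetD[OF ab(4)], rule imageI) (use that in auto)
      then show ?thesis by simp
    qed
    then have "h ` {- b..- a} \<subseteq> {R/2..3/4*R}" by blast
    then show ?thesis using s0 s1 R ab by (intro exI[of _ "- b"] exI[of _ "- a"]) auto
  qed
  then obtain a b where ab: "0 \<le> a" "a \<le> b" "b \<le> 1" "h ` {a..b} \<subseteq> {R/2..3/4*R}" "\<bar>h a - h b\<bar> = R/4"
    by blast
  have "R / 4 \<le> dist (g a) (g b)"
    using norm_triangle_ineq3[of "g a - t" "g b - t"] ab(5) by (simp add: h_def dist_norm)
  then have "ennreal (R / 4) \<le> ennreal (dist (g a) (g b))" by (rule ennreal_leI)
  also have "\<dots> \<le> emeasure (arclength_measure g) (annulus (arclength_measure g) t R)"
  proof (rule emeasure_arclength_measure_ge[OF annulus_sets_borel ab(1-3)], rule image_subsetI)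
    fix s assume s: "s \<in> {a<..b}"
    then have "h s \<in> {R/2..3/4*R}" by (intro subsetD[OF ab(4)] imageI) auto
    moreover have "g s \<in> path_image g" using s ab by (auto simp: path_image_def)
    ultimately show "g s \<in> annulus (arclength_measure g) t R"
      using R by (auto simp: annulus_def portion_def h_def)
  qed
  finally show ?thesis .
qed

end

section \<open>Indices of comparable submultiplicative functions\<close>

text \<open>Power trick: with \<open>r\<close> the value of \<open>\<Phi>\<close> at
  \<open>x\<close>, the hypothesis at \<open>x ^ n\<close> bounds \<open>\<Psi>\<close> there by
  \<open>C * x powr (- n a) * r ^ n\<close>. Dividing logarithms by the negative number
  \<open>n * ln x\<close> leaves the error \<open>ln C / (n * ln x)\<close>, which tends to 0, so
  the constant \<open>C\<close> does not affect the index.\<close>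

lemma lower_index_le:
  fixes \<Phi> \<Psi> :: "real \<Rightarrow> ennreal"
  assumes sub: "\<And>x y. x \<in> {0<..<1} \<Longrightarrow> y \<in> {0<..<1} \<Longrightarrow> \<Phi> (x * y) \<le> \<Phi> x * \<Phi> y"
    and le: "\<And>x. x \<in> {0<..<1} \<Longrightarrow> \<Psi> x \<le> ennreal (C * x powr (- a)) * \<Phi> x"
    and C: "0 < C"
  shows "lower_index \<Phi> \<le> ereal a + lower_index \<Psi>"
  unfolding lower_index_def[of \<Phi>]
proof (rule SUP_least)
  fix x :: real assume x: "x \<in> {0<..<1}"
  then have lnx: "ln x < 0" by simp
  have ge: "elog (\<Psi> y) / ereal (ln y) \<le> lower_index \<Psi>" if "y \<in> {0<..<1}" for y
    unfolding lower_index_def using that by (rule SUP_upper)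
  \<comment> \<open>\<open>elog 0\<close> is minus infinity and \<open>ln y\<close> is negative, so
    a single zero already makes the supremum infinite.\<close>
  have zero: "lower_index \<Psi> = \<infinity>" if "y \<in> {0<..<1}" "\<Psi> y = 0" for y
    using ge[OF that(1)] that by (auto simp: elog_def divide_ereal_def)
  consider "\<Phi> x = 0" | "\<Phi> x = \<infinity>" | r where "\<Phi> x = ennreal r" "0 < r"
    by (metis ennreal_cases ennreal_0 infinity_ennreal_def le_less)
  then show "elog (\<Phi> x) / ereal (ln x) \<le> ereal a + lower_index \<Psi>"
  proof cases
    case 1
    then have "lower_index \<Psi> = \<infinity>" using le[OF x] zero[OF x] by simp
    then show ?thesis by simp
  next
    case 2
    then show ?thesis using lnx by (simp add: elog_def divide_ereal_def)
  next
    case (3 r)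
    have pow: "\<Phi> (x ^ Suc n) \<le> ennreal (r ^ Suc n)" for n
    proof (induction n)
      case (Suc n)
      have "x ^ Suc n \<in> {0<..<1}" using x by (simp add: power_less_one_iff del: power_Suc)
      then have "\<Phi> (x * x ^ Suc n) \<le> \<Phi> x * \<Phi> (x ^ Suc n)" by (intro sub x)
      also have "\<dots> \<le> ennreal r * ennreal (r ^ Suc n)" using 3 Suc by (intro mult_mono) auto
      finally show ?case using 3 by (simp add: ennreal_mult)
    qed (use 3 in simp)
    have *: "ereal (ln r / ln x - a + (ln C / ln x) / real (Suc n)) \<le> lower_index \<Psi>" for n
    proof -
      let ?N = "real (Suc n)"
      have xn: "x ^ Suc n \<in> {0<..<1}" using x by (simp add: power_less_one_iff del: power_Suc)
      have "\<Psi> (x ^ Suc n) \<le> ennreal (C * (x ^ Suc n) powr (- a)) * ennreal (r ^ Suc n)"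
        using le[OF xn] pow[of n] by (meson mult_left_mono order_trans zero_le)
      also have "\<dots> = ennreal (C * (x ^ Suc n) powr (- a) * r ^ Suc n)"
        using C 3 by (simp add: ennreal_mult)
      finally have up: "\<Psi> (x ^ Suc n) \<le> ennreal (C * (x ^ Suc n) powr (- a) * r ^ Suc n)" .
      consider "\<Psi> (x ^ Suc n) = 0" | s where "\<Psi> (x ^ Suc n) = ennreal s" "0 < s"
        using up by (metis ennreal_cases ennreal_0 le_less top.extremum_uniqueI ennreal_neq_top)
      then show ?thesis
      proof cases
        case 1
        then show ?thesis using zero[OF xn] by simp
      next
        case (2 s)
        have "s \<le> C * (x ^ Suc n) powr (- a) * r ^ Suc n"
          using up 2 C 3 x by (subst (asm) 2) (auto simp: ennreal_le_iff)
        then have "ln s \<le> ln (C * (x ^ Suc n) powr (- a) * r ^ Suc n)"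
          using 2 by simp
        also have "\<dots> = ln C + (- a) * (?N * ln x) + ?N * ln r"
          using C 3 x by (subst ln_mult; simp)+ (simp add: ln_powr ln_realpow distrib_right add.commute flip: power_Suc)
        finally have ls: "ln s \<le> ln C + (- a) * (?N * ln x) + ?N * ln r" .
        have neg: "?N * ln x < 0" using lnx by (simp add: mult_pos_neg)
        have "ln r / ln x - a + (ln C / ln x) / ?N = (ln C + (- a) * (?N * ln x) + ?N * ln r) / (?N * ln x)"
          using lnx by (simp add: field_simps del: of_nat_Suc)
        also have "\<dots> \<le> ln s / (?N * ln x)"
          using ls neg by (intro divide_right_mono_neg) auto
        finally have "ereal (ln r / ln x - a + (ln C / ln x) / ?N) \<le> ereal (ln s / (?N * ln x))" by simp
        also have "\<dots> = elog (\<Psi> (x ^ Suc n)) / ereal (ln (x ^ Suc n))"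
        proof -
          have "ln (x ^ Suc n) = ?N * ln x" using x by (simp add: ln_realpow del: power_Suc)
          then show ?thesis using 2 lnx by (simp add: elog_def del: power_Suc)
        qed
        also have "\<dots> \<le> lower_index \<Psi>" by (rule ge[OF xn])
        finally show ?thesis .
      qed
    qed
    have "(\<lambda>n. ln r / ln x - a + (ln C / ln x) * (1 / real (Suc n))) \<longlonglongrightarrow> ln r / ln x - a + (ln C / ln x) * 0"
      by (intro tendsto_intros LIMSEQ_Suc[OF lim_1_over_n])
    then have "(\<lambda>n. ereal (ln r / ln x - a + (ln C / ln x) / real (Suc n))) \<longlonglongrightarrow> ereal (ln r / ln x - a)"
      by simp
    then have "ereal (ln r / ln x - a) \<le> lower_index \<Psi>"
      by (rule LIMSEQ_le_const2) (use * in blast)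
    then show ?thesis using 3 lnx by (cases "lower_index \<Psi>") (auto simp: elog_def)
  qed
qed

lemma lower_index_compare:
  fixes \<Phi> \<Psi> :: "real \<Rightarrow> ennreal"
  assumes "\<And>x y. x \<in> {0<..<1} \<Longrightarrow> y \<in> {0<..<1} \<Longrightarrow> \<Phi> (x * y) \<le> \<Phi> x * \<Phi> y"
    and "\<And>x y. x \<in> {0<..<1} \<Longrightarrow> y \<in> {0<..<1} \<Longrightarrow> \<Psi> (x * y) \<le> \<Psi> x * \<Psi> y"
    and "\<And>x. x \<in> {0<..<1} \<Longrightarrow> \<Psi> x \<le> ennreal (C * x powr (- a)) * \<Phi> x"
    and "\<And>x. x \<in> {0<..<1} \<Longrightarrow> \<Phi> x \<le> ennreal (C * x powr a) * \<Psi> x"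
    and "0 < C"
  shows "lower_index \<Phi> = ereal a + lower_index \<Psi>"
proof (rule antisym)
  show "lower_index \<Phi> \<le> ereal a + lower_index \<Psi>"
    using assms by (intro lower_index_le)
  have "lower_index \<Psi> \<le> ereal (- a) + lower_index \<Phi>"
    using assms by (intro lower_index_le[where C = C]) auto
  then show "ereal a + lower_index \<Psi> \<le> lower_index \<Phi>"
    by (cases "lower_index \<Psi>"; cases "lower_index \<Phi>") auto
qed

text \<open>Inversion exchanges the two sides of 1 and changes the sign of \<open>ln x\<close>. The
  limit argument is thereby needed for the lower index only; in the comparison the exponent
  \<open>a\<close> becomes \<open>- a\<close>.\<close>

lemma upper_index_eq_lower_index: "upper_index \<Phi> = - lower_index (\<lambda>x. \<Phi> (inverse x))"
proof -
  have "{1<..} = inverse ` {0<..<(1::real)}"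
  proof (rule set_eqI, rule iffI)
    fix x :: real assume "x \<in> {1<..}"
    then show "x \<in> inverse ` {0<..<1}"
      by (intro image_eqI[of _ _ "inverse x"]) (auto simp: inverse_less_1_iff)
  next
    fix x :: real assume "x \<in> inverse ` {0<..<1}"
    then obtain y where "x = inverse y" "y \<in> {0<..<1}" by (rule imageE)
    then show "x \<in> {1<..}" using one_less_inverse[of y] by simp
  qed
  then have "upper_index \<Phi> = (INF x\<in>{0<..<1}. elog (\<Phi> (inverse x)) / ereal (ln (inverse x)))"
    unfolding upper_index_def by (simp add: image_image)
  also have "\<dots> = (INF x\<in>{0<..<1}. - (elog (\<Phi> (inverse x)) / ereal (ln x)))"
  proof (rule INF_cong[OF refl])
    fix x :: real assume x: "x \<in> {0<..<1}"
    have "ln (inverse x) = - ln x" using x by (simp add: ln_inverse)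
    then show "elog (\<Phi> (inverse x)) / ereal (ln (inverse x)) = - (elog (\<Phi> (inverse x)) / ereal (ln x))"
      using x by (cases "elog (\<Phi> (inverse x))") (auto simp: divide_ereal_def)
  qed
  also have "\<dots> = - (SUP x\<in>{0<..<1}. elog (\<Phi> (inverse x)) / ereal (ln x))"
    by (rule ereal_INF_uminus_eq)
  finally show ?thesis by (simp add: lower_index_def)
qed

lemma upper_index_compare:
  fixes \<Phi> \<Psi> :: "real \<Rightarrow> ennreal"
  assumes \<Phi>: "\<And>x y. x \<in> {1<..} \<Longrightarrow> y \<in> {1<..} \<Longrightarrow> \<Phi> (x * y) \<le> \<Phi> x * \<Phi> y"
    and \<Psi>: "\<And>x y. x \<in> {1<..} \<Longrightarrow> y \<in> {1<..} \<Longrightarrow> \<Psi> (x * y) \<le> \<Psi> x * \<Psi> y"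
    and le: "\<And>x. x \<in> {1<..} \<Longrightarrow> \<Psi> x \<le> ennreal (C * x powr (- a)) * \<Phi> x"
    and ge: "\<And>x. x \<in> {1<..} \<Longrightarrow> \<Phi> x \<le> ennreal (C * x powr a) * \<Psi> x"
    and C: "0 < C"
  shows "upper_index \<Phi> = ereal a + upper_index \<Psi>"
proof -
  have inv: "inverse x \<in> {1<..}" if "x \<in> {0<..<1}" for x :: real
    using that by (simp add: one_less_inverse_iff)
  have "lower_index (\<lambda>x. \<Phi> (inverse x)) = ereal (- a) + lower_index (\<lambda>x. \<Psi> (inverse x))"
  proof (rule lower_index_compare[where C = C])
    fix x :: real assume x: "x \<in> {0<..<1}"
    have "inverse x powr b = x powr (- b)" for b
      using x by (simp add: powr_minus inverse_powr)
    then show "\<Psi> (inverse x) \<le> ennreal (C * x powr (- (- a))) * \<Phi> (inverse x)"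
      "\<Phi> (inverse x) \<le> ennreal (C * x powr (- a)) * \<Psi> (inverse x)"
      using le[OF inv[OF x]] ge[OF inv[OF x]] by simp_all
  qed (use \<Phi> \<Psi> inv C in auto)
  then show ?thesis
    unfolding upper_index_eq_lower_index
    by (cases "lower_index (\<lambda>x. \<Psi> (inverse x))") auto
qed

section \<open>Nakano norms and Hoelder's inequality\<close>

lemma epowr_ennreal [simp]: "0 \<le> x \<Longrightarrow> epowr (ennreal x) a = ennreal (x powr a)"
  by (simp add: epowr_def)

lemma epowr_mono:
  assumes "x \<le> y" "0 \<le> a"
  shows "epowr x a \<le> epowr y a"
  using assms by (cases x; cases y) (auto simp: epowr_def powr_mono2 top_unique intro!: ennreal_leI)

lemma nakano_modular_mono:
  assumes "\<And>\<tau>. \<tau> \<in> space M \<Longrightarrow> f \<tau> \<le> h \<tau>" "\<And>\<tau>. \<tau> \<in> space M \<Longrightarrow> 0 \<le> p \<tau>"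
  shows "nakano_modular M p f \<le> nakano_modular M p h"
  unfolding nakano_modular_def by (intro nn_integral_mono epowr_mono assms)

lemma nakano_norm_le:
  assumes "0 < l" "nakano_modular M p (\<lambda>\<tau>. f \<tau> / ennreal l) \<le> 1"
  shows "nakano_norm M p f \<le> ennreal l"
  unfolding nakano_norm_def using assms by (intro INF_lower) simp

text \<open>Strictness provides an admissible \<open>l\<close> below \<open>k\<close>, so the
  infimum need not be shown to be attained.\<close>

lemma nakano_modular_le_1:
  assumes "nakano_norm M p f < ennreal k" "\<And>\<tau>. \<tau> \<in> space M \<Longrightarrow> 0 \<le> p \<tau>"
  shows "nakano_modular M p (\<lambda>\<tau>. f \<tau> / ennreal k) \<le> 1"
proof -
  obtain l where l: "0 < l" "nakano_modular M p (\<lambda>\<tau>. f \<tau> / ennreal l) \<le> 1" "ennreal l < ennreal k"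
    using assms(1) unfolding nakano_norm_def INF_less_iff by auto
  have "nakano_modular M p (\<lambda>\<tau>. f \<tau> / ennreal k) \<le> nakano_modular M p (\<lambda>\<tau>. f \<tau> / ennreal l)"
  proof (intro nakano_modular_mono assms)
    have "l < k" using l by (simp add: ennreal_less_iff)
    then have "inverse (ennreal k) \<le> inverse (ennreal l)"
      using l(1) by (simp add: inverse_ennreal ennreal_leI le_imp_inverse_le)
    then show "f \<tau> / ennreal k \<le> f \<tau> / ennreal l" for \<tau>
      unfolding divide_ennreal_def by (rule mult_left_mono) simp
  qed
  then show ?thesis using l by simp
qed

lemma nakano_norm_mono:
  assumes "\<And>\<tau>. \<tau> \<in> space M \<Longrightarrow> f \<tau> \<le> h \<tau>" "\<And>\<tau>. \<tau> \<in> space M \<Longrightarrow> 0 \<le> p \<tau>"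
  shows "nakano_norm M p f \<le> nakano_norm M p h"
  unfolding nakano_norm_def
proof (rule INF_superset_mono)
  show "{l. 0 < l \<and> nakano_modular M p (\<lambda>\<tau>. h \<tau> / ennreal l) \<le> 1} \<subseteq>
        {l. 0 < l \<and> nakano_modular M p (\<lambda>\<tau>. f \<tau> / ennreal l) \<le> 1}"
  proof
    fix l assume "l \<in> {l. 0 < l \<and> nakano_modular M p (\<lambda>\<tau>. h \<tau> / ennreal l) \<le> 1}"
    moreover have "nakano_modular M p (\<lambda>\<tau>. f \<tau> / ennreal l) \<le> nakano_modular M p (\<lambda>\<tau>. h \<tau> / ennreal l)"
      by (intro nakano_modular_mono assms divide_right_mono_ennreal)
    ultimately show "l \<in> {l. 0 < l \<and> nakano_modular M p (\<lambda>\<tau>. f \<tau> / ennreal l) \<le> 1}" by auto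
  qed
qed simp

lemma associate_norm_mono:
  assumes "\<And>\<tau>. \<tau> \<in> space M \<Longrightarrow> f \<tau> \<le> h \<tau>"
  shows "associate_norm M p f \<le> associate_norm M p h"
  unfolding associate_norm_def
  by (rule SUP_mono, erule bexI[rotated]) (intro nn_integral_mono mult_left_mono assms, simp_all)

text \<open>Dividing by \<open>k\<close>, which is strictly above the norm, puts \<open>h\<close>
  into the unit ball over which \<open>associate_norm\<close> takes its supremum. That ball consists
  of complex-valued functions, hence the almost everywhere finiteness and the passage through
  \<open>enn2real\<close>.\<close>

lemma Hoelder_aux:
  assumes [measurable]: "h \<in> borel_measurable M" "f \<in> borel_measurable M"
    and fin: "AE \<tau> in M. h \<tau> < \<infinity>" and p: "\<And>\<tau>. \<tau> \<in> space M \<Longrightarrow> 0 \<le> p \<tau>"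
    and less: "nakano_norm M p h < ennreal k"
  shows "(\<integral>\<^sup>+ \<tau>. h \<tau> * f \<tau> \<partial>M) \<le> ennreal k * associate_norm M p f"
proof -
  have k: "0 < k" using less by (metis ennreal_eq_0_iff linorder_not_le not_less_zero)
  define u where "u \<tau> = complex_of_real (enn2real (h \<tau>) / k)" for \<tau>
  have [measurable]: "u \<in> borel_measurable M" unfolding u_def by measurable
  have u: "AE \<tau> in M. ennreal (cmod (u \<tau>)) = h \<tau> / ennreal k"
    using fin
  proof eventually_elim
    case (elim \<tau>)
    then obtain r where "h \<tau> = ennreal r" "0 \<le> r" by (cases "h \<tau>") auto
    then show ?case using k by (simp add: u_def divide_ennreal norm_divide)
  qed
  have "nakano_modular M p (\<lambda>\<tau>. ennreal (cmod (u \<tau>)) / ennreal 1) = nakano_modular M p (\<lambda>\<tau>. h \<tau> / ennreal k)"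
    unfolding nakano_modular_def
    by (rule nn_integral_cong_AE) (use u in eventually_elim, simp add: divide_ennreal_def)
  also have "\<dots> \<le> 1" by (rule nakano_modular_le_1[OF less p])
  finally have "nakano_norm M p (\<lambda>\<tau>. ennreal (cmod (u \<tau>))) \<le> ennreal 1"
    by (intro nakano_norm_le) auto
  then have "u \<in> nakano_unit_ball M p" by (simp add: nakano_unit_ball_def)
  then have "(\<integral>\<^sup>+ \<tau>. ennreal (cmod (u \<tau>)) * f \<tau> \<partial>M) \<le> associate_norm M p f"
    unfolding associate_norm_def by (rule SUP_upper)
  then have "ennreal k * (\<integral>\<^sup>+ \<tau>. ennreal (cmod (u \<tau>)) * f \<tau> \<partial>M) \<le> ennreal k * associate_norm M p f"
    by (rule mult_left_mono) simp
  also have "ennreal k * (\<integral>\<^sup>+ \<tau>. ennreal (cmod (u \<tau>)) * f \<tau> \<partial>M) = (\<integral>\<^sup>+ \<tau>. ennreal k * (ennreal (cmod (u \<tau>)) * f \<tau>) \<partial>M)"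
    by (rule nn_integral_cmult[symmetric]) measurable
  also have "\<dots> = (\<integral>\<^sup>+ \<tau>. h \<tau> * f \<tau> \<partial>M)"
    by (rule nn_integral_cong_AE) (use u in eventually_elim,
      use k in \<open>simp add: ennreal_times_divide mult.assoc[symmetric] ennreal_mult_divide_eq mult.commute[of "ennreal k"]\<close>)
  finally show ?thesis .
qed

text \<open>The two disjunctions exclude the indeterminate products \<open>0 * \<infinity>\<close>.\<close>

lemma Hoelder:
  assumes "h \<in> borel_measurable M" "f \<in> borel_measurable M"
    and "AE \<tau> in M. h \<tau> < \<infinity>" and "\<And>\<tau>. \<tau> \<in> space M \<Longrightarrow> 0 \<le> p \<tau>"
    and "nakano_norm M p h \<noteq> 0 \<or> associate_norm M p f \<noteq> \<infinity>"
    and "nakano_norm M p h \<noteq> \<infinity> \<or> associate_norm M p f \<noteq> 0"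
  shows "(\<integral>\<^sup>+ \<tau>. h \<tau> * f \<tau> \<partial>M) \<le> nakano_norm M p h * associate_norm M p f"
proof (cases "nakano_norm M p h = \<infinity> \<or> associate_norm M p f = \<infinity>")
  case True
  then have "nakano_norm M p h * associate_norm M p f = \<infinity>"
    using assms(5,6) by (simp add: ennreal_mult_eq_top_iff) blast
  then show ?thesis by simp
next
  case False
  then obtain n s where n: "nakano_norm M p h = ennreal n" "0 \<le> n"
    and s: "associate_norm M p f = ennreal s" "0 \<le> s"
    by (metis ennreal_cases infinity_ennreal_def)
  show ?thesis
  proof (rule ennreal_le_epsilon)
    fix e :: real assume e: "0 < e"
    \<comment> \<open>The excess over the norm, multiplied by \<open>s\<close>, stays below
      \<open>e\<close>; adding 1 covers \<open>s = 0\<close>.\<close>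
    let ?k = "n + e / (s + 1)"
    have "(\<integral>\<^sup>+ \<tau>. h \<tau> * f \<tau> \<partial>M) \<le> ennreal ?k * associate_norm M p f"
    proof (rule Hoelder_aux[OF assms(1-4)])
      have "0 < e / (s + 1)" using e s by simp
      then show "nakano_norm M p h < ennreal ?k" unfolding n(1) using n(2) by (simp add: ennreal_less_iff)
    qed
    also have "\<dots> = ennreal (?k * s)"
      unfolding s(1) by (rule ennreal_mult[symmetric]) (use n s e in simp_all)
    also have "\<dots> \<le> ennreal (n * s + e)"
    proof (rule ennreal_leI)
      have "e / (s + 1) * s \<le> e / (s + 1) * (s + 1)" using e s by (intro mult_left_mono) auto
      also have "\<dots> = e" using s by simp
      finally have "e / (s + 1) * s \<le> e" .
      then show "?k * s \<le> n * s + e" by (simp add: distrib_right)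
    qed
    also have "\<dots> = nakano_norm M p h * associate_norm M p f + ennreal e"
      unfolding n(1) s(1) using n(2) s(2) e by (simp add: ennreal_mult ennreal_plus)
    finally show "(\<integral>\<^sup>+ \<tau>. h \<tau> * f \<tau> \<partial>M) \<le> nakano_norm M p h * associate_norm M p f + ennreal e" .
  qed
qed

section \<open>Norms of indicators near a Carleson point\<close>

lemma nn_integral_indicator_bound:
  assumes "E \<in> sets M" "\<And>\<tau>. \<tau> \<in> space M \<Longrightarrow> f \<tau> \<le> ennreal c * indicator E \<tau>"
  shows "(\<integral>\<^sup>+ \<tau>. f \<tau> \<partial>M) \<le> ennreal c * emeasure M E"
  using nn_integral_mono[of M f "\<lambda>\<tau>. ennreal c * indicator E \<tau>"] assms
  by (simp add: nn_integral_cmult_indicator)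

text \<open>The interface between geometry and analysis: \<open>C\<close> is the Carleson constant,
  \<open>L\<close> the constant of logarithmic continuity of \<open>p\<close> at \<open>t\<close>,
  and the fraction \<open>1/4\<close> comes from crossing the annulus.\<close>

locale carleson_point =
  fixes M :: "complex measure" and t :: complex and p :: "complex \<Rightarrow> real" and C L :: real
  assumes portion_sets [measurable]: "portion M t R \<in> sets M"
    and portion_le: "0 < R \<Longrightarrow> emeasure M (portion M t R) \<le> ennreal (C * R)"
    and annulus_ge: "0 < R \<Longrightarrow> R \<le> max_dist M t \<Longrightarrow> ennreal (R / 4) \<le> emeasure M (annulus M t R)"
    and max_dist_positive: "0 < max_dist M t"
    and dist_le_max_dist: "\<tau> \<in> space M \<Longrightarrow> cmod (\<tau> - t) \<le> max_dist M t"
    and p_measurable [measurable]: "p \<in> borel_measurable M"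
    and p_gt_1: "\<tau> \<in> space M \<Longrightarrow> 1 < p \<tau>"
    and p_t_gt_1: "1 < p t"
    and log_Hoelder: "\<tau> \<in> portion M t (1/2) \<Longrightarrow> \<bar>p \<tau> - p t\<bar> \<le> L / (- ln (cmod (\<tau> - t)))"
    and C_pos: "0 < C" and L_pos: "0 < L"
begin

abbreviation "a \<equiv> 1 / p t"
text \<open>Portions are cut out by a strict inequality, so only a radius beyond the maximal
  distance yields the whole curve. Uniform estimates are stated up to this radius.\<close>

abbreviation "D \<equiv> max_dist M t + 1"

lemma annulus_sets [measurable]: "annulus M t R \<in> sets M"
  unfolding annulus_def by measurable

lemma a_bounds: "0 < a" "a < 1"
  using p_t_gt_1 by auto

lemma D_bounds: "1 < D" "max_dist M t < D" "0 < D"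
  using max_dist_positive by auto

lemma portion_subset: "portion M t R \<subseteq> space M"
  by (auto simp: portion_def)

lemma annulus_subset: "annulus M t R \<subseteq> portion M t R"
  by (auto simp: annulus_def)

lemma portion_eq_space: "max_dist M t < R \<Longrightarrow> portion M t R = space M"
  using dist_le_max_dist by (fastforce simp: portion_def)

lemma p_nonneg: "\<tau> \<in> space M \<Longrightarrow> 0 \<le> p \<tau>"
  using p_gt_1[of \<tau>] by simp

text \<open>Since \<open>cmod (\<tau> - t) < R < 1/2\<close>, the modulus of continuity at
  \<open>\<tau>\<close> is at most \<open>L / (- ln R)\<close>, and multiplication by
  \<open>ln R\<close> cancels the logarithm. Exponentiated, this makes
  \<open>R powr (a * p \<tau>)\<close> equal to \<open>R\<close> up to a factor between
  \<open>exp (- L)\<close> and \<open>exp L\<close>.\<close>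

lemma exponent_deviation:
  assumes R: "0 < R" "R < 1/2" and \<tau>: "\<tau> \<in> portion M t R"
  shows "\<bar>a * p \<tau> * ln R - ln R\<bar> \<le> L"
proof -
  have "\<bar>p \<tau> - p t\<bar> * (- ln R) \<le> L"
  proof (cases "\<tau> = t")
    case False
    have d: "0 < cmod (\<tau> - t)" "cmod (\<tau> - t) < R" using False \<tau> by (auto simp: portion_def)
    have lnR: "0 < - ln R" using R by simp
    have "- ln R \<le> - ln (cmod (\<tau> - t))" using d R by simp
    moreover have "\<bar>p \<tau> - p t\<bar> \<le> L / (- ln (cmod (\<tau> - t)))"
      using \<tau> R by (intro log_Hoelder) (auto simp: portion_def)
    moreover have "L / (- ln (cmod (\<tau> - t))) \<le> L / (- ln R)"
      using calculation(1) lnR L_pos by (intro divide_left_mono mult_pos_pos) auto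
    ultimately have "\<bar>p \<tau> - p t\<bar> \<le> L / (- ln R)" by linarith
    then show ?thesis using lnR by (simp only: pos_le_divide_eq)
  qed (use L_pos in simp)
  moreover have "a * p \<tau> * ln R - ln R = a * ((p \<tau> - p t) * ln R)"
    using p_t_gt_1 by (simp add: field_simps)
  moreover have "\<bar>a * ((p \<tau> - p t) * ln R)\<bar> \<le> 1 * \<bar>(p \<tau> - p t) * ln R\<bar>"
    unfolding abs_mult[of a] using a_bounds by (intro mult_right_mono) auto
  moreover have "\<bar>(p \<tau> - p t) * ln R\<bar> = \<bar>p \<tau> - p t\<bar> * (- ln R)"
    using R by (simp add: abs_mult)
  ultimately show ?thesis by simp
qed

lemma powr_exponent_le:
  assumes R: "0 < R" "R < 1/2" and \<tau>: "\<tau> \<in> portion M t R"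
  shows "R powr (a * p \<tau>) \<le> exp L * R" "R powr (- (a * p \<tau>)) \<le> exp L / R"
proof -
  have *: "\<bar>a * p \<tau> * ln R - ln R\<bar> \<le> L" by (rule exponent_deviation[OF assms])
  have "R powr (a * p \<tau>) = exp (a * p \<tau> * ln R)" using R by (simp add: powr_def)
  also have "\<dots> \<le> exp (L + ln R)" using * by simp
  also have "\<dots> = exp L * R" using R by (simp add: exp_add)
  finally show "R powr (a * p \<tau>) \<le> exp L * R" .
  have "R powr (- (a * p \<tau>)) = exp (- (a * p \<tau> * ln R))" using R by (simp add: powr_def)
  also have "\<dots> \<le> exp (L - ln R)" using * by simp
  also have "\<dots> = exp L / R" using R by (simp add: exp_diff)
  finally show "R powr (- (a * p \<tau>)) \<le> exp L / R" .
qed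

text \<open>For radii between \<open>1/2\<close> and \<open>D\<close> this lets a bound independent
  of \<open>R\<close> be absorbed into a multiple of \<open>R powr a\<close> or
  \<open>R powr (1 - a)\<close>.\<close>

lemma half_le_powr:
  assumes "1/2 \<le> R" "0 \<le> b" "b \<le> 1"
  shows "1/2 \<le> R powr (b :: real)"
proof -
  have "(1/2) powr 1 \<le> (1/2 :: real) powr b" using assms by (intro powr_mono') auto
  also have "\<dots> \<le> R powr b" using assms by (intro powr_mono2) auto
  finally show ?thesis by simp
qed

lemma nakano_norm_portion_le_aux:
  assumes l: "0 < l" and le: "\<And>\<tau>. \<tau> \<in> portion M t R \<Longrightarrow> (1 / l) powr p \<tau> \<le> b"
    and R: "0 < R" and b: "0 \<le> b" "b * (C * R) \<le> 1"
  shows "nakano_norm M p (indicator (portion M t R)) \<le> ennreal l"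
proof (rule nakano_norm_le[OF l])
  have "nakano_modular M p (\<lambda>\<tau>. indicator (portion M t R) \<tau> / ennreal l) \<le> ennreal b * emeasure M (portion M t R)"
    unfolding nakano_modular_def
  proof (rule nn_integral_indicator_bound[OF portion_sets])
    fix \<tau> assume \<tau>: "\<tau> \<in> space M"
    show "epowr (indicator (portion M t R) \<tau> / ennreal l) (p \<tau>) \<le> ennreal b * indicator (portion M t R) \<tau>"
    proof (cases "\<tau> \<in> portion M t R")
      case True
      have "(1::ennreal) / ennreal l = ennreal (1 / l)"
        using l divide_ennreal[of 1 l] by simp
      then show ?thesis using True le[OF True] l by (simp add: ennreal_leI)
    next
      case False
      then show ?thesis using epowr_ennreal[of 0 "p \<tau>"] by (simp add: divide_ennreal_def)
    qed
  qed
  also have "\<dots> \<le> ennreal b * ennreal (C * R)"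
    by (intro mult_left_mono portion_le R) simp
  also have "\<dots> = ennreal (b * (C * R))" using b R C_pos by (intro ennreal_mult[symmetric]) auto
  also have "\<dots> \<le> 1" using b(2) by (simp add: ennreal_le_1)
  finally show "nakano_modular M p (\<lambda>\<tau>. indicator (portion M t R) \<tau> / ennreal l) \<le> 1" .
qed

lemma nakano_norm_portion:
  obtains K where "0 < K"
    "\<And>R. 0 < R \<Longrightarrow> R \<le> D \<Longrightarrow> nakano_norm M p (indicator (portion M t R)) \<le> ennreal (K * R powr a)"
proof -
  \<comment> \<open>The trial values of the norm are \<open>k1 * R powr a\<close> for small
    \<open>R\<close> and \<open>k2\<close> otherwise. Being at least 1 gives
    \<open>(1 / k) powr p \<tau> \<le> 1 / k\<close> for both constants; the other entry of each
    maximum brings the modular below 1. The final \<open>2 * k2\<close> compensates for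
    \<open>half_le_powr\<close>.\<close>
  define k1 where "k1 = max 1 (C * exp L)"
  define k2 where "k2 = max 1 (C * D)"
  have k: "1 \<le> k1" "1 \<le> k2" "C * exp L \<le> k1" "C * D \<le> k2" by (auto simp: k1_def k2_def)
  have "nakano_norm M p (indicator (portion M t R)) \<le> ennreal ((k1 + 2 * k2) * R powr a)"
    if R: "0 < R" "R \<le> D" for R
  proof (cases "R < 1/2")
    case True
    have Ra: "0 < R powr a" using R by simp
    have "nakano_norm M p (indicator (portion M t R)) \<le> ennreal (k1 * R powr a)"
    proof (rule nakano_norm_portion_le_aux[where b = "exp L / (k1 * R)"])
      fix \<tau> assume \<tau>: "\<tau> \<in> portion M t R"
      then have p: "1 < p \<tau>" using p_gt_1 portion_subset by blast
      have "(1 / (k1 * R powr a)) powr p \<tau> = (1 / k1) powr p \<tau> * R powr (- (a * p \<tau>))"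
        using k R by (simp add: powr_divide powr_mult powr_powr powr_minus field_simps)
      also have "\<dots> \<le> (1 / k1) powr 1 * (exp L / R)"
        using k p by (intro mult_mono powr_mono' powr_exponent_le R True \<tau>) auto
      also have "\<dots> = exp L / (k1 * R)" using k by simp
      finally show "(1 / (k1 * R powr a)) powr p \<tau> \<le> exp L / (k1 * R)" .
    qed (use k R Ra in \<open>auto simp: field_simps\<close>)
    also have "\<dots> \<le> ennreal ((k1 + 2 * k2) * R powr a)"
      using k Ra by (intro ennreal_leI mult_right_mono) auto
    finally show ?thesis .
  next
    case False
    have "nakano_norm M p (indicator (portion M t R)) \<le> ennreal k2"
    proof (rule nakano_norm_portion_le_aux[where b = "1 / k2"])
      fix \<tau> assume \<tau>: "\<tau> \<in> portion M t R"
      then have p: "1 < p \<tau>" using p_gt_1 portion_subset by blast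
      have "(1 / k2) powr p \<tau> \<le> (1 / k2) powr 1" using k p by (intro powr_mono') auto
      then show "(1 / k2) powr p \<tau> \<le> 1 / k2" using k by simp
    next
      have "C * R \<le> C * D" using R C_pos by simp
      then show "1 / k2 * (C * R) \<le> 1" using k by (simp add: field_simps)
    qed (use k R in auto)
    also have "\<dots> \<le> ennreal ((k1 + 2 * k2) * R powr a)"
    proof (rule ennreal_leI)
      have "k2 \<le> 2 * k2 * R powr a" using half_le_powr[of R a] False a_bounds k by simp
      also have "\<dots> \<le> (k1 + 2 * k2) * R powr a" using k by (intro mult_right_mono) auto
      finally show "k2 \<le> (k1 + 2 * k2) * R powr a" .
    qed
    finally show ?thesis .
  qed
  moreover have "0 < k1 + 2 * k2" using k by simp
  ultimately show thesis using that by blast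
qed

text \<open>The hypothesis is a Young inequality with threshold \<open>s\<close>. Applied to
  \<open>r = cmod (f \<tau>) / 2\<close> and integrated, its first term sees only the length of the
  portion and its second only the modular of \<open>f\<close>.\<close>

lemma associate_norm_portion_le_aux:
  assumes le: "\<And>\<tau> r. \<tau> \<in> portion M t R \<Longrightarrow> 0 \<le> r \<Longrightarrow> r \<le> s + b * r powr p \<tau>"
    and R: "0 < R" and b: "0 \<le> b" "0 \<le> s"
  shows "associate_norm M p (indicator (portion M t R)) \<le> ennreal (2 * (s * (C * R) + b))"
  unfolding associate_norm_def
proof (rule SUP_least)
  fix f assume "f \<in> nakano_unit_ball M p"
  then have [measurable]: "f \<in> borel_measurable M" and f: "nakano_norm M p (\<lambda>\<tau>. ennreal (cmod (f \<tau>))) \<le> 1"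
    by (auto simp: nakano_unit_ball_def)
  \<comment> \<open>Membership in the unit ball gives only a weak inequality; halving
    \<open>f\<close> creates the strict one and is the source of the factor 2.\<close>
  from f have "nakano_norm M p (\<lambda>\<tau>. ennreal (cmod (f \<tau>))) < ennreal 2"
    by (rule le_less_trans) simp
  then have "nakano_modular M p (\<lambda>\<tau>. ennreal (cmod (f \<tau>)) / ennreal 2) \<le> 1"
    by (rule nakano_modular_le_1[OF _ p_nonneg])
  also have "nakano_modular M p (\<lambda>\<tau>. ennreal (cmod (f \<tau>)) / ennreal 2) =
      (\<integral>\<^sup>+ \<tau>. ennreal ((cmod (f \<tau>) / 2) powr p \<tau>) \<partial>M)"
    unfolding nakano_modular_def by (intro nn_integral_cong) (subst divide_ennreal; simp)
  finally have m: "(\<integral>\<^sup>+ \<tau>. ennreal ((cmod (f \<tau>) / 2) powr p \<tau>) \<partial>M) \<le> 1" .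
  have "(\<integral>\<^sup>+ \<tau>. ennreal (cmod (f \<tau>)) * indicator (portion M t R) \<tau> \<partial>M) \<le>
      (\<integral>\<^sup>+ \<tau>. ennreal (2 * s) * indicator (portion M t R) \<tau> + ennreal (2 * b) * ennreal ((cmod (f \<tau>) / 2) powr p \<tau>) \<partial>M)"
  proof (rule nn_integral_mono)
    fix \<tau>
    show "ennreal (cmod (f \<tau>)) * indicator (portion M t R) \<tau> \<le>
      ennreal (2 * s) * indicator (portion M t R) \<tau> + ennreal (2 * b) * ennreal ((cmod (f \<tau>) / 2) powr p \<tau>)"
    proof (cases "\<tau> \<in> portion M t R")
      case True
      have "cmod (f \<tau>) \<le> 2 * s + 2 * b * (cmod (f \<tau>) / 2) powr p \<tau>"
        using le[OF True, of "cmod (f \<tau>) / 2"] by (simp add: mult.assoc)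
      then have "ennreal (cmod (f \<tau>)) \<le> ennreal (2 * s + 2 * b * (cmod (f \<tau>) / 2) powr p \<tau>)"
        by (rule ennreal_leI)
      also have "\<dots> = ennreal (2 * s) + ennreal (2 * b) * ennreal ((cmod (f \<tau>) / 2) powr p \<tau>)"
        using b by (subst ennreal_plus) (auto simp: ennreal_mult)
      finally show ?thesis using True by simp
    qed simp
  qed
  also have "\<dots> = ennreal (2 * s) * emeasure M (portion M t R) + ennreal (2 * b) * (\<integral>\<^sup>+ \<tau>. ennreal ((cmod (f \<tau>) / 2) powr p \<tau>) \<partial>M)"
    by (subst nn_integral_add) (simp_all add: nn_integral_cmult nn_integral_cmult_indicator)
  also have "\<dots> \<le> ennreal (2 * s) * ennreal (C * R) + ennreal (2 * b) * 1"
    by (intro add_mono mult_left_mono portion_le R m) auto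
  also have "\<dots> = ennreal (2 * s * (C * R) + 2 * b)"
    using b R C_pos by (subst ennreal_plus) (auto simp: ennreal_mult)
  also have "2 * s * (C * R) + 2 * b = 2 * (s * (C * R) + b)" by (simp add: algebra_simps)
  finally show "(\<integral>\<^sup>+ \<tau>. ennreal (cmod (f \<tau>)) * indicator (portion M t R) \<tau> \<partial>M) \<le> ennreal (2 * (s * (C * R) + b))" .
qed

lemma associate_norm_portion:
  obtains K where "0 < K"
    "\<And>R. 0 < R \<Longrightarrow> R \<le> D \<Longrightarrow> associate_norm M p (indicator (portion M t R)) \<le> ennreal (K * R powr (1 - a))"
proof -
  \<comment> \<open>The first summand serves radii below \<open>1/2\<close>; the second serves the
    others, with its 2 doubled to offset the lower bound \<open>1/2\<close> for the power.\<close>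
  define K where "K = 2 * (C + exp L) + 4 * (C * D + 1)"
  have "0 < C * D" using C_pos D_bounds by simp
  have "associate_norm M p (indicator (portion M t R)) \<le> ennreal (K * R powr (1 - a))"
    if R: "0 < R" "R \<le> D" for R
  proof (cases "R < 1/2")
    case True
    \<comment> \<open>This threshold is the height at which the indicator of the portion has norm of
      order 1. Above it, \<open>r / s \<le> (r / s) powr p \<tau>\<close>, and the powers of
      \<open>R\<close> combine to a multiple of \<open>r powr p \<tau> * R\<close>.\<close>
    define s where "s = R powr (- a)"
    have s: "0 < s" using R by (simp add: s_def)
    have sR: "s * R = R powr (1 - a)"
    proof -
      have "s * R = R powr (- a) * R powr 1" using R by (simp add: s_def)
      also have "\<dots> = R powr (1 - a)" by (simp only: powr_add[symmetric]) simp
      finally show ?thesis .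
    qed
    have "associate_norm M p (indicator (portion M t R)) \<le> ennreal (2 * (s * (C * R) + s * (exp L * R)))"
    proof (rule associate_norm_portion_le_aux)
      fix \<tau> and r :: real assume \<tau>: "\<tau> \<in> portion M t R" and r: "0 \<le> r"
      then have p: "1 < p \<tau>" using p_gt_1 portion_subset by blast
      show "r \<le> s + s * (exp L * R) * r powr p \<tau>"
      proof (cases "r \<le> s")
        case True
        have "0 \<le> s * (exp L * R) * r powr p \<tau>" using s R by simp
        then show ?thesis using True by linarith
      next
        case False
        have "(r / s) powr 1 \<le> (r / s) powr p \<tau>" using False s p by (intro powr_mono) auto
        also have "\<dots> = r powr p \<tau> / s powr p \<tau>" using r s by (simp add: powr_divide)
        also have "\<dots> = r powr p \<tau> * R powr (a * p \<tau>)"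
          unfolding s_def powr_powr using R by (simp add: powr_minus field_simps)
        also have "\<dots> \<le> r powr p \<tau> * (exp L * R)"
          by (intro mult_left_mono powr_exponent_le R \<open>R < 1/2\<close> \<tau>) simp
        finally have "r / s \<le> r powr p \<tau> * (exp L * R)" using r s by simp
        then have "r \<le> s * (r powr p \<tau> * (exp L * R))" using s by (simp add: pos_divide_le_eq mult.commute)
        then show ?thesis using s by (simp add: ac_simps)
      qed
    qed (use s R in auto)
    also have "2 * (s * (C * R) + s * (exp L * R)) = (2 * (C + exp L)) * (s * R)"
      by (simp add: algebra_simps)
    also have "ennreal \<dots> \<le> ennreal (K * R powr (1 - a))"
      unfolding sR using \<open>0 < C * D\<close> by (intro ennreal_leI mult_right_mono) (auto simp: K_def)
    finally show ?thesis .
  next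
    case False
    have "associate_norm M p (indicator (portion M t R)) \<le> ennreal (2 * (1 * (C * R) + 1))"
    proof (rule associate_norm_portion_le_aux)
      fix \<tau> and r :: real assume \<tau>: "\<tau> \<in> portion M t R" and r: "0 \<le> r"
      then have p: "1 < p \<tau>" using p_gt_1 portion_subset by blast
      show "r \<le> 1 + 1 * r powr p \<tau>"
      proof (cases "r \<le> 1")
        case False
        then have "r powr 1 \<le> r powr p \<tau>" using p by (intro powr_mono) auto
        then show ?thesis using False by simp
      qed (use r in \<open>simp add: add_increasing2\<close>)
    qed (use R in auto)
    also have "\<dots> \<le> ennreal (K * R powr (1 - a))"
    proof (rule ennreal_leI)
      have "2 * (1 * (C * R) + 1) \<le> 4 * (C * D + 1) * (1/2)" using R C_pos by simp
      also have "\<dots> \<le> K * R powr (1 - a)"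
        using half_le_powr[of R "1 - a"] False a_bounds \<open>0 < C * D\<close> C_pos
        by (intro mult_mono) (auto simp: K_def intro: add_nonneg_nonneg)
      finally show "2 * (1 * (C * R) + 1) \<le> K * R powr (1 - a)" .
    qed
    finally show ?thesis .
  qed
  moreover have "0 < K" using C_pos \<open>0 < C * D\<close> by (simp add: K_def add_pos_pos)
  ultimately show thesis using that by blast
qed

end

section \<open>Jensen's inequality and mean oscillation\<close>

lemma set_integrable_of_integrable:
  fixes f :: "'a \<Rightarrow> real"
  assumes "integrable M f" "E \<in> sets M"
  shows "set_integrable M E f"
  unfolding set_integrable_def by (rule integrable_mult_indicator[OF assms(2,1)])

text \<open>The graph of \<open>exp\<close> lies above its tangent at the mean \<open>c\<close>; the
  tangent inequality is integrated over \<open>E\<close>.\<close>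

lemma set_Jensen_exp:
  fixes f :: "'a \<Rightarrow> real"
  assumes f: "integrable M f" "integrable M (\<lambda>x. exp (f x))"
    and E: "E \<in> sets M" "emeasure M E \<noteq> \<infinity>" "0 < measure M E"
  shows "measure M E * exp ((LINT x:E|M. f x) / measure M E) \<le> (LINT x:E|M. exp (f x))"
proof -
  define c where "c = (LINT x:E|M. f x) / measure M E"
  have fE: "set_integrable M E f" and eE: "set_integrable M E (\<lambda>x. exp (f x))"
    using f E(1) by (auto intro: set_integrable_of_integrable)
  have kE: "set_integrable M E (\<lambda>_. k)" for k :: real
    using E by (auto simp: set_integrable_def less_top intro!: integrable_mult_left)
  have "measure M E * exp c = exp c * ((1 - c) * measure M E + (LINT x:E|M. f x))"
    using E(3) by (simp add: c_def field_simps)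
  also have "\<dots> = (LINT x:E|M. exp c * ((1 - c) + f x))"
    using E by (subst set_integral_mult_right, subst set_integral_add) (auto intro: kE fE simp: set_integral_const)
  also have "\<dots> \<le> (LINT x:E|M. exp (f x))"
  proof (rule set_integral_mono)
    show "set_integrable M E (\<lambda>x. exp c * ((1 - c) + f x))"
      by (intro set_integrable_mult_right set_integral_add kE fE)
    fix x
    have "(1 - c) + f x \<le> exp (f x - c)" using exp_ge_add_one_self[of "f x - c"] by linarith
    then have "exp c * ((1 - c) + f x) \<le> exp c * exp (f x - c)" by (rule mult_left_mono) simp
    also have "\<dots> = exp (f x)" by (simp add: exp_add[symmetric])
    finally show "exp c * ((1 - c) + f x) \<le> exp (f x)" .
  qed (rule eE)
  finally show ?thesis by (simp add: c_def)
qed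

text \<open>Pointwise, the deviation from the mean \<open>c\<close> is at most
  \<open>exp (f x - c) + exp (c - f x)\<close>. Jensen bounds each of the two exponential integrals
  from below, so the bound on their product gives \<open>exp (- c) * W \<le> B * m\<close> and
  \<open>exp c * U \<le> B * m\<close>.\<close>

lemma set_mean_oscillation_le:
  fixes f :: "'a \<Rightarrow> real"
  assumes f: "integrable M f" "integrable M (\<lambda>x. exp (f x))" "integrable M (\<lambda>x. exp (- f x))"
    and E: "E \<in> sets M" "emeasure M E \<noteq> \<infinity>" "0 < measure M E"
    and le: "(LINT x:E|M. exp (f x)) * (LINT x:E|M. exp (- f x)) \<le> B * (measure M E)\<^sup>2"
  shows "(LINT x:E|M. \<bar>f x - (LINT x:E|M. f x) / measure M E\<bar>) \<le> 2 * B * measure M E"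
proof -
  define c where "c = (LINT x:E|M. f x) / measure M E"
  define m where "m = measure M E"
  define W where "W = (LINT x:E|M. exp (f x))"
  define U where "U = (LINT x:E|M. exp (- f x))"
  have m: "0 < m" using E by (simp add: m_def)
  have W: "m * exp c \<le> W"
    unfolding W_def m_def c_def by (rule set_Jensen_exp[OF f(1,2) E])
  have "m * exp ((LINT x:E|M. - f x) / m) \<le> U"
    unfolding U_def m_def using f by (intro set_Jensen_exp E) auto
  then have U: "m * exp (- c) \<le> U"
    by (simp add: c_def m_def set_lebesgue_integral_def)
  have WU: "W * U \<le> B * m\<^sup>2" using le by (simp add: W_def U_def m_def)
  have pos: "0 < W" "0 < U" using W U m by (auto intro: less_le_trans[OF mult_pos_pos[OF m exp_gt_zero]])
  have "W * (m * exp (- c)) \<le> B * m\<^sup>2" using U WU pos by (meson mult_left_mono order_trans less_imp_le)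
  then have 1: "exp (- c) * W \<le> B * m" using m by (simp add: power2_eq_square ac_simps)
  have "(m * exp c) * U \<le> B * m\<^sup>2" using W WU pos by (meson mult_right_mono order_trans less_imp_le)
  then have 2: "exp c * U \<le> B * m" using m by (simp add: power2_eq_square ac_simps)
  have eE: "set_integrable M E (\<lambda>x. exp (f x))" "set_integrable M E (\<lambda>x. exp (- f x))" "set_integrable M E f"
    using f E(1) by (auto intro: set_integrable_of_integrable)
  have kE: "set_integrable M E (\<lambda>_. k)" for k :: real
    using E by (auto simp: set_integrable_def less_top intro!: integrable_mult_left)
  have "(LINT x:E|M. \<bar>f x - c\<bar>) \<le> (LINT x:E|M. exp (- c) * exp (f x) + exp c * exp (- f x))"
  proof (rule set_integral_mono)
    show "set_integrable M E (\<lambda>x. \<bar>f x - c\<bar>)"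
      by (intro set_integrable_abs set_integral_diff eE kE)
    show "set_integrable M E (\<lambda>x. exp (- c) * exp (f x) + exp c * exp (- f x))"
      by (intro set_integrable_mult_right set_integral_add eE)
    fix x
    have "f x - c \<le> exp (f x - c)" "c - f x \<le> exp (c - f x)"
      using exp_ge_add_one_self[of "f x - c"] exp_ge_add_one_self[of "c - f x"] by linarith+
    moreover have "0 < exp (f x - c)" "0 < exp (c - f x)" by simp_all
    ultimately have "\<bar>f x - c\<bar> \<le> exp (f x - c) + exp (c - f x)" by linarith
    also have "\<dots> = exp (- c) * exp (f x) + exp c * exp (- f x)"
      by (simp add: exp_add[symmetric])
    finally show "\<bar>f x - c\<bar> \<le> exp (- c) * exp (f x) + exp c * exp (- f x)" .
  qed
  also have "\<dots> = exp (- c) * W + exp c * U"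
    unfolding W_def U_def
    by (subst set_integral_add) (auto intro!: set_integrable_mult_right eE)
  also have "\<dots> \<le> 2 * B * m" using 1 2 by simp
  finally show ?thesis by (simp add: c_def m_def)
qed

lemma nn_set_integral_pos:
  assumes [measurable]: "f \<in> borel_measurable M" "E \<in> sets M" and pos: "\<And>x. 0 < (f x :: real)"
    and ne: "emeasure M E \<noteq> 0"
  shows "(\<integral>\<^sup>+ x. ennreal (f x) * indicator E x \<partial>M) \<noteq> 0"
proof
  assume "(\<integral>\<^sup>+ x. ennreal (f x) * indicator E x \<partial>M) = 0"
  then have "AE x in M. ennreal (f x) * indicator E x = 0"
    by (subst (asm) nn_integral_0_iff_AE) auto
  then have "AE x in M. x \<notin> E"
  proof eventually_elim
    case (elim x)
    then show ?case using pos[of x] by (auto simp: indicator_def split: if_splits)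
  qed
  then have "E \<in> null_sets M" by (simp add: AE_iff_null_sets)
  then show False using ne by auto
qed

lemma nn_set_integral_eq:
  assumes "set_integrable M E f" "\<And>x. 0 \<le> (f x :: real)"
  shows "(\<integral>\<^sup>+ x. ennreal (f x) * indicator E x \<partial>M) = ennreal (LINT x:E|M. f x)"
proof -
  have "(\<integral>\<^sup>+ x. ennreal (f x) * indicator E x \<partial>M) = (\<integral>\<^sup>+ x. ennreal (indicator E x *\<^sub>R f x) \<partial>M)"
    by (intro nn_integral_cong) (auto simp: indicator_def)
  also have "\<dots> = ennreal (LINT x:E|M. f x)"
    unfolding set_lebesgue_integral_def
    by (rule nn_integral_eq_integral) (use assms in \<open>auto simp: set_integrable_def\<close>)
  finally show ?thesis .
qed

section \<open>Consequences of the condition on the weight\<close>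

locale weighted_carleson_point = carleson_point M t p C L for M t p C L +
  fixes w :: "complex \<Rightarrow> ennreal" and K0 K1 K2 :: real
  assumes w_measurable [measurable]: "w \<in> borel_measurable M"
    and w_AE: "AE \<tau> in M. 0 < w \<tau> \<and> w \<tau> < \<infinity>"
    and A_condition: "0 < R \<Longrightarrow> nakano_norm M p (\<lambda>\<tau>. w \<tau> * indicator (portion M t R) \<tau>)
          * associate_norm M p (\<lambda>\<tau>. indicator (portion M t R) \<tau> / w \<tau>) \<le> ennreal (K0 * R)"
    and nakano_norm_portion_le: "0 < R \<Longrightarrow> R \<le> max_dist M t + 1 \<Longrightarrow>
          nakano_norm M p (indicator (portion M t R)) \<le> ennreal (K1 * R powr (1 / p t))"
    and associate_norm_portion_le: "0 < R \<Longrightarrow> R \<le> max_dist M t + 1 \<Longrightarrow>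
          associate_norm M p (indicator (portion M t R)) \<le> ennreal (K2 * R powr (1 - 1 / p t))"
    and K_pos: "0 < K0" "0 < K1" "0 < K2"
begin

abbreviation "wnorm E \<equiv> nakano_norm M p (\<lambda>\<tau>. w \<tau> * indicator E \<tau>)"
abbreviation "vnorm E \<equiv> associate_norm M p (\<lambda>\<tau>. indicator E \<tau> / w \<tau>)"

definition logw :: "complex \<Rightarrow> real" where "logw \<tau> = ln (enn2real (w \<tau>))"

lemma logw_measurable [measurable]: "logw \<in> borel_measurable M"
  unfolding logw_def[abs_def] by measurable

lemma w_eq_exp: "AE \<tau> in M. w \<tau> = ennreal (exp (logw \<tau>)) \<and> 1 / w \<tau> = ennreal (exp (- logw \<tau>))"
  using w_AE
proof eventually_elim
  case (elim \<tau>)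
  then obtain r where r: "w \<tau> = ennreal r" "0 < r" by (cases "w \<tau>") (auto simp: less_le)
  then have "logw \<tau> = ln r" by (simp add: logw_def)
  moreover have "1 / w \<tau> = ennreal (1 / r)" using r divide_ennreal[of 1 r] by simp
  ultimately show ?case using r by (simp add: exp_minus inverse_eq_divide)
qed

text \<open>The equality holds everywhere because the default values agree: where \<open>w\<close>
  is 0 or infinite, both sides are 0.\<close>

lemma logw_eq: "real_of_ereal (elog (w \<tau>)) = logw \<tau>"
  by (simp add: elog_def logw_def)

lemma wnorm_mono: "E \<subseteq> F \<Longrightarrow> wnorm E \<le> wnorm F"
  by (intro nakano_norm_mono p_nonneg mult_left_mono) (auto simp: indicator_def)

lemma vnorm_mono: "E \<subseteq> F \<Longrightarrow> vnorm E \<le> vnorm F"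
  by (intro associate_norm_mono divide_right_mono_ennreal) (auto simp: indicator_def)

text \<open>The set \<open>E\<close> is kept general because it is later the portion itself, for
  mean oscillation, and the annulus, for the indices.\<close>

context
  fixes E :: "complex set" and R :: real
  assumes E [measurable]: "E \<in> sets M" and E_sub: "E \<subseteq> portion M t R"
    and R: "0 < R" "R \<le> D" and E_ne: "emeasure M E \<noteq> 0"
begin

lemma norm_indicator_le:
  "nakano_norm M p (indicator E) \<le> ennreal (K1 * R powr a)"
  "associate_norm M p (indicator E) \<le> ennreal (K2 * R powr (1 - a))"
proof -
  have le: "indicator E \<tau> \<le> (indicator (portion M t R) \<tau> :: ennreal)" for \<tau>
    using E_sub by (auto simp: indicator_def)
  show "nakano_norm M p (indicator E) \<le> ennreal (K1 * R powr a)"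
    by (rule order_trans[OF nakano_norm_mono[OF le p_nonneg] nakano_norm_portion_le[OF R]])
  show "associate_norm M p (indicator E) \<le> ennreal (K2 * R powr (1 - a))"
    by (rule order_trans[OF associate_norm_mono[OF le] associate_norm_portion_le[OF R]])
qed

text \<open>Otherwise Hoelder's inequality for the product of the indicator with itself would give
  \<open>E\<close> length 0. This rules out \<open>0 * \<infinity>\<close> below, where the
  indicator is paired with a norm not yet known to be finite.\<close>

lemma norm_indicator_nonzero:
  "nakano_norm M p (indicator E) \<noteq> 0" "associate_norm M p (indicator E) \<noteq> 0"
proof -
  have fin: "nakano_norm M p (indicator E) \<noteq> \<infinity>" "associate_norm M p (indicator E) \<noteq> \<infinity>"
    using norm_indicator_le by (auto simp: top_unique)
  then obtain n where n: "nakano_norm M p (indicator E) = ennreal n" "0 \<le> n"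
    by (cases "nakano_norm M p (indicator E)") auto
  have int: "(\<integral>\<^sup>+ \<tau>. indicator E \<tau> * indicator E \<tau> \<partial>M) = emeasure M E"
    by (simp flip: indicator_inter_arith)
  have "(\<integral>\<^sup>+ \<tau>. indicator E \<tau> * indicator E \<tau> \<partial>M) \<le> ennreal (n + 1) * associate_norm M p (indicator E)"
  proof (rule Hoelder_aux)
    show "nakano_norm M p (indicator E) < ennreal (n + 1)"
      unfolding n(1) using n(2) by (simp add: ennreal_less_iff del: ennreal_plus)
  qed (use p_nonneg in \<open>auto split: split_indicator\<close>)
  then show a: "associate_norm M p (indicator E) \<noteq> 0"
    using E_ne unfolding int by auto
  have "(\<integral>\<^sup>+ \<tau>. indicator E \<tau> * indicator E \<tau> \<partial>M) \<le> nakano_norm M p (indicator E) * associate_norm M p (indicator E)"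
    by (rule Hoelder) (use fin a p_nonneg in \<open>auto split: split_indicator\<close>)
  then show "nakano_norm M p (indicator E) \<noteq> 0"
    using E_ne unfolding int by auto
qed

lemma nn_integral_exp_logw_le:
  "(\<integral>\<^sup>+ \<tau>. ennreal (exp (logw \<tau>)) * indicator E \<tau> \<partial>M) \<le> wnorm E * ennreal (K2 * R powr (1 - a))"
proof -
  have "(\<integral>\<^sup>+ \<tau>. ennreal (exp (logw \<tau>)) * indicator E \<tau> \<partial>M) = (\<integral>\<^sup>+ \<tau>. (w \<tau> * indicator E \<tau>) * indicator E \<tau> \<partial>M)"
    by (rule nn_integral_cong_AE) (use w_eq_exp in eventually_elim, auto simp: indicator_def)
  also have "\<dots> \<le> wnorm E * associate_norm M p (indicator E)"
  proof (rule Hoelder)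
    show "AE \<tau> in M. w \<tau> * indicator E \<tau> < \<infinity>"
      using w_AE by eventually_elim (auto simp: indicator_def)
    show "wnorm E \<noteq> 0 \<or> associate_norm M p (indicator E) \<noteq> \<infinity>"
      using norm_indicator_le by (auto simp: top_unique)
  qed (use norm_indicator_nonzero p_nonneg in auto)
  also have "\<dots> \<le> wnorm E * ennreal (K2 * R powr (1 - a))"
    by (rule mult_left_mono[OF norm_indicator_le(2)]) simp
  finally show ?thesis .
qed

lemma nn_integral_exp_minus_logw_le:
  "(\<integral>\<^sup>+ \<tau>. ennreal (exp (- logw \<tau>)) * indicator E \<tau> \<partial>M) \<le> ennreal (K1 * R powr a) * vnorm E"
proof -
  have "(\<integral>\<^sup>+ \<tau>. ennreal (exp (- logw \<tau>)) * indicator E \<tau> \<partial>M) = (\<integral>\<^sup>+ \<tau>. indicator E \<tau> * (indicator E \<tau> / w \<tau>) \<partial>M)"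
    by (rule nn_integral_cong_AE) (use w_eq_exp in eventually_elim, auto simp: indicator_def)
  also have "\<dots> \<le> nakano_norm M p (indicator E) * vnorm E"
  proof (rule Hoelder)
    show "nakano_norm M p (indicator E) \<noteq> \<infinity> \<or> vnorm E \<noteq> 0"
      using norm_indicator_le by (auto simp: top_unique)
  qed (use norm_indicator_nonzero p_nonneg in \<open>auto split: split_indicator\<close>)
  also have "\<dots> \<le> ennreal (K1 * R powr a) * vnorm E"
    by (rule mult_right_mono[OF norm_indicator_le(1)]) simp
  finally show ?thesis .
qed

lemma nn_integral_exp_nonzero:
  "(\<integral>\<^sup>+ \<tau>. ennreal (exp (logw \<tau>)) * indicator E \<tau> \<partial>M) \<noteq> 0"
  "(\<integral>\<^sup>+ \<tau>. ennreal (exp (- logw \<tau>)) * indicator E \<tau> \<partial>M) \<noteq> 0"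
  by (rule nn_set_integral_pos; use E_ne in simp)+

lemma wnorm_vnorm_nonzero: "wnorm E \<noteq> 0" "vnorm E \<noteq> 0"
  using nn_integral_exp_logw_le nn_integral_exp_minus_logw_le nn_integral_exp_nonzero by auto

lemma wnorm_vnorm_le: "wnorm E * vnorm E \<le> ennreal (K0 * R)"
  by (rule order_trans[OF mult_mono A_condition]) (use wnorm_mono vnorm_mono E_sub R in auto)

text \<open>The condition on \<open>w\<close> makes the product finite, and as neither factor is 0,
  neither can be infinite.\<close>

lemma wnorm_vnorm_finite: "wnorm E \<noteq> \<infinity>" "vnorm E \<noteq> \<infinity>"
proof -
  have "wnorm E * vnorm E \<noteq> \<infinity>" using wnorm_vnorm_le by (auto simp: top_unique)
  then show "wnorm E \<noteq> \<infinity>" "vnorm E \<noteq> \<infinity>"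
    using wnorm_vnorm_nonzero by (simp_all add: ennreal_mult_eq_top_iff)
qed

text \<open>The indicator factors almost everywhere as \<open>w\<close> times \<open>1/w\<close> on
  \<open>E\<close>. This counterpart of the condition on \<open>w\<close> is what makes
  \<open>G_fun\<close> submultiplicative.\<close>

lemma emeasure_le_wnorm_vnorm: "emeasure M E \<le> wnorm E * vnorm E"
proof -
  have "emeasure M E = (\<integral>\<^sup>+ \<tau>. (w \<tau> * indicator E \<tau>) * (indicator E \<tau> / w \<tau>) \<partial>M)"
  proof (subst nn_integral_indicator[symmetric, OF E], rule nn_integral_cong_AE, use w_AE in eventually_elim)
    fix \<tau> assume "0 < w \<tau> \<and> w \<tau> < \<infinity>"
    then show "indicator E \<tau> = (w \<tau> * indicator E \<tau>) * (indicator E \<tau> / w \<tau>)"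
      by (auto simp: indicator_def ennreal_times_divide)
  qed
  also have "\<dots> \<le> wnorm E * vnorm E"
  proof (rule Hoelder)
    show "AE \<tau> in M. w \<tau> * indicator E \<tau> < \<infinity>"
      using w_AE by eventually_elim (auto simp: indicator_def)
  qed (use wnorm_vnorm_nonzero p_nonneg in auto)
  finally show ?thesis .
qed

text \<open>One power of \<open>R\<close> comes from the condition on \<open>w\<close>; the other is
  \<open>R powr (1 - a) * R powr a\<close> from the two indicator norms, so the exponent at
  \<open>t\<close> cancels.\<close>

lemma nn_integral_product_le:
  "(\<integral>\<^sup>+ \<tau>. ennreal (exp (logw \<tau>)) * indicator E \<tau> \<partial>M) * (\<integral>\<^sup>+ \<tau>. ennreal (exp (- logw \<tau>)) * indicator E \<tau> \<partial>M)
    \<le> ennreal (K0 * K1 * K2 * R\<^sup>2)"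
proof -
  have "(\<integral>\<^sup>+ \<tau>. ennreal (exp (logw \<tau>)) * indicator E \<tau> \<partial>M) * (\<integral>\<^sup>+ \<tau>. ennreal (exp (- logw \<tau>)) * indicator E \<tau> \<partial>M)
     \<le> (wnorm E * ennreal (K2 * R powr (1 - a))) * (ennreal (K1 * R powr a) * vnorm E)"
    by (intro mult_mono nn_integral_exp_logw_le nn_integral_exp_minus_logw_le) auto
  also have "\<dots> = (wnorm E * vnorm E) * (ennreal (K2 * R powr (1 - a)) * ennreal (K1 * R powr a))"
    by (simp only: ac_simps)
  also have "\<dots> \<le> ennreal (K0 * R) * (ennreal (K2 * R powr (1 - a)) * ennreal (K1 * R powr a))"
    by (rule mult_right_mono[OF wnorm_vnorm_le]) simp
  also have "\<dots> = ennreal (K0 * R * (K2 * R powr (1 - a) * (K1 * R powr a)))"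
    using K_pos R by (simp add: ennreal_mult)
  also have "K0 * R * (K2 * R powr (1 - a) * (K1 * R powr a)) = K0 * K1 * K2 * R * (R powr (1 - a) * R powr a)"
    by (simp only: ac_simps)
  also have "R powr (1 - a) * R powr a = R"
    using R by (simp add: powr_add[symmetric] del: powr_add)
  finally show ?thesis by (simp add: power2_eq_square mult.assoc)
qed

lemma nn_integral_exp_finite:
  "(\<integral>\<^sup>+ \<tau>. ennreal (exp (logw \<tau>)) * indicator E \<tau> \<partial>M) \<noteq> \<infinity>"
  "(\<integral>\<^sup>+ \<tau>. ennreal (exp (- logw \<tau>)) * indicator E \<tau> \<partial>M) \<noteq> \<infinity>"
proof -
  have "(\<integral>\<^sup>+ \<tau>. ennreal (exp (logw \<tau>)) * indicator E \<tau> \<partial>M) * (\<integral>\<^sup>+ \<tau>. ennreal (exp (- logw \<tau>)) * indicator E \<tau> \<partial>M) \<noteq> \<infinity>"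
    using nn_integral_product_le by (auto simp: top_unique)
  then show "(\<integral>\<^sup>+ \<tau>. ennreal (exp (logw \<tau>)) * indicator E \<tau> \<partial>M) \<noteq> \<infinity>"
    "(\<integral>\<^sup>+ \<tau>. ennreal (exp (- logw \<tau>)) * indicator E \<tau> \<partial>M) \<noteq> \<infinity>"
    using nn_integral_exp_nonzero by (simp_all add: ennreal_mult_eq_top_iff)
qed

end

end

section \<open>Lengths of portions are comparable to their radii\<close>

context carleson_point
begin

lemma emeasure_finite: "E \<in> sets M \<Longrightarrow> emeasure M E \<noteq> \<infinity>"
proof -
  assume "E \<in> sets M"
  then have "emeasure M E \<le> emeasure M (portion M t D)"
    using portion_eq_space[of D] by (intro emeasure_mono) (auto dest: sets.sets_into_space)
  also have "\<dots> \<le> ennreal (C * D)" using D_bounds by (intro portion_le) auto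
  finally show ?thesis by (auto simp: top_unique)
qed

lemma emeasure_eq: "E \<in> sets M \<Longrightarrow> emeasure M E = ennreal (measure M E)"
  using emeasure_finite by (intro emeasure_eq_ennreal_measure) auto

lemma measure_portion_le: "0 < R \<Longrightarrow> measure M (portion M t R) \<le> C * R"
  using portion_le[of R] C_pos by (simp add: emeasure_eq)

lemma measure_annulus_ge: "0 < R \<Longrightarrow> R \<le> max_dist M t \<Longrightarrow> R / 4 \<le> measure M (annulus M t R)"
  using annulus_ge[of R] by (simp add: emeasure_eq)

lemma measure_mono: "E \<subseteq> F \<Longrightarrow> F \<in> sets M \<Longrightarrow> E \<in> sets M \<Longrightarrow> measure M E \<le> measure M F"
  using emeasure_mono[of E F M] by (simp add: emeasure_eq)

text \<open>Up to the maximal distance \<open>d\<close> the annulus inside the portion gives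
  \<open>R / 4\<close>. Beyond it only \<open>d / 4\<close> is available, and the constant is chosen
  so that the bound equals \<open>d / 4\<close> at \<open>R = D\<close>.\<close>

lemma measure_portion_ge:
  assumes "0 < R" "R \<le> D"
  shows "max_dist M t / (4 * D) * R \<le> measure M (portion M t R)"
proof (cases "R \<le> max_dist M t")
  case True
  have "max_dist M t / (4 * D) * R \<le> 1 / 4 * R"
    using max_dist_positive assms by (intro mult_right_mono) (auto simp: field_simps)
  also have "\<dots> \<le> measure M (annulus M t R)" using measure_annulus_ge[of R] assms True by simp
  also have "\<dots> \<le> measure M (portion M t R)" by (intro measure_mono annulus_subset) auto
  finally show ?thesis .
next
  case False
  let ?d = "max_dist M t"
  have "?d / (4 * D) * R \<le> ?d / (4 * D) * D"
    using max_dist_positive assms by (intro mult_left_mono) auto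
  also have "\<dots> = ?d / 4"
  proof -
    have "x / (4 * y) * y = x / 4" if "y \<noteq> 0" for x y :: real using that by simp
    then show ?thesis using D_bounds by (metis less_irrefl)
  qed
  also have "\<dots> \<le> measure M (annulus M t ?d)" using measure_annulus_ge[of ?d] max_dist_positive by simp
  also have "\<dots> \<le> measure M (portion M t ?d)" by (intro measure_mono annulus_subset) auto
  also have "\<dots> \<le> measure M (portion M t R)" using False by (intro measure_mono portion_sets) (auto simp: portion_def)
  finally show ?thesis .
qed

lemma measure_portion_pos: "0 < R \<Longrightarrow> R \<le> D \<Longrightarrow> 0 < measure M (portion M t R)"
  using measure_portion_ge[of R] max_dist_positive D_bounds
  by (meson less_le_trans mult_pos_pos divide_pos_pos zero_less_numeral)

end

section \<open>Mean oscillation of the logarithm and norms on annuli\<close>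

context weighted_carleson_point
begin

lemma integrable_exp_logw: "integrable M (\<lambda>\<tau>. exp (logw \<tau>))" "integrable M (\<lambda>\<tau>. exp (- logw \<tau>))"
proof -
  have ne: "emeasure M (portion M t D) \<noteq> 0"
    using measure_portion_pos[of D] D_bounds by (simp add: emeasure_eq)
  have sp: "portion M t D = space M" using portion_eq_space[of D] by simp
  have *: "integrable M u" if [measurable]: "u \<in> borel_measurable M" and "\<And>\<tau>. 0 < u \<tau>"
      and "(\<integral>\<^sup>+ \<tau>. ennreal (u \<tau>) * indicator (portion M t D) \<tau> \<partial>M) \<noteq> \<infinity>" for u :: "complex \<Rightarrow> real"
  proof (rule integrableI_bounded)
    have "(\<integral>\<^sup>+ \<tau>. ennreal (norm (u \<tau>)) \<partial>M) = (\<integral>\<^sup>+ \<tau>. ennreal (u \<tau>) * indicator (portion M t D) \<tau> \<partial>M)"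
      unfolding sp by (rule nn_integral_cong) (use that(2) in \<open>simp add: less_imp_le\<close>)
    then show "(\<integral>\<^sup>+ \<tau>. ennreal (norm (u \<tau>)) \<partial>M) < \<infinity>" using that(3) by (simp add: less_top)
  qed measurable
  show "integrable M (\<lambda>\<tau>. exp (logw \<tau>))" "integrable M (\<lambda>\<tau>. exp (- logw \<tau>))"
    by (rule *; use nn_integral_exp_finite[OF portion_sets order_refl _ _ ne] D_bounds in simp)+
qed

lemma integrable_logw: "integrable M logw"
proof (rule Bochner_Integration.integrable_bound)
  show "integrable M (\<lambda>\<tau>. exp (logw \<tau>) + exp (- logw \<tau>))"
    by (intro Bochner_Integration.integrable_add integrable_exp_logw)
  have "\<bar>logw \<tau>\<bar> \<le> exp (logw \<tau>) + exp (- logw \<tau>)" for \<tau>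
  proof -
    have "logw \<tau> \<le> exp (logw \<tau>)" "- logw \<tau> \<le> exp (- logw \<tau>)" "0 < exp (logw \<tau>)" "0 < exp (- logw \<tau>)"
      using exp_ge_add_one_self[of "logw \<tau>"] exp_ge_add_one_self[of "- logw \<tau>"] by (linarith | simp)+
    then show ?thesis by linarith
  qed
  then show "AE \<tau> in M. norm (logw \<tau>) \<le> norm (exp (logw \<tau>) + exp (- logw \<tau>))"
    by (auto intro: order_trans)
qed measurable

lemma set_integrable_logw:
  assumes "E \<in> sets M"
  shows "set_integrable M E logw" "set_integrable M E (\<lambda>\<tau>. exp (logw \<tau>))" "set_integrable M E (\<lambda>\<tau>. exp (- logw \<tau>))"
  using assms integrable_logw integrable_exp_logw by (auto intro: set_integrable_of_integrable)

abbreviation "\<Omega> R \<equiv> mean M t (\<lambda>\<tau>. elog (w \<tau>)) R"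

lemma mean_eq: "\<Omega> R = (LINT \<tau>:portion M t R|M. logw \<tau>) / measure M (portion M t R)"
  by (simp add: mean_def logw_eq)

text \<open>This is the constant \<open>2 * B\<close> of \<open>set_mean_oscillation_le\<close>,
  where \<open>B\<close> arises by trading \<open>R\<^sup>2\<close> for the squared length of the
  portion through \<open>measure_portion_ge\<close>.\<close>

definition "osc_const = 2 * (K0 * K1 * K2 / (max_dist M t / (4 * D))\<^sup>2)"

lemma osc_const_pos: "0 < osc_const"
  using K_pos max_dist_positive by (simp add: osc_const_def)

lemma oscillation_le:
  assumes R: "0 < R" "R \<le> D"
  shows "(LINT \<tau>:portion M t R|M. \<bar>logw \<tau> - \<Omega> R\<bar>) \<le> osc_const * measure M (portion M t R)"
proof -
  let ?P = "portion M t R" and ?c = "max_dist M t / (4 * D)"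
  have m: "0 < measure M ?P" by (rule measure_portion_pos[OF R])
  then have ne: "emeasure M ?P \<noteq> 0" by (simp add: emeasure_eq)
  have c: "0 < ?c" using max_dist_positive by simp
  have "(LINT \<tau>:?P|M. exp (logw \<tau>)) * (LINT \<tau>:?P|M. exp (- logw \<tau>)) \<le> K0 * K1 * K2 * R\<^sup>2"
  proof -
    have "ennreal (LINT \<tau>:?P|M. exp (logw \<tau>)) * ennreal (LINT \<tau>:?P|M. exp (- logw \<tau>)) \<le> ennreal (K0 * K1 * K2 * R\<^sup>2)"
      using nn_integral_product_le[OF portion_sets order_refl R ne]
      by (simp add: nn_set_integral_eq set_integrable_logw)
    moreover have "0 \<le> (LINT \<tau>:?P|M. exp (logw \<tau>))" "0 \<le> (LINT \<tau>:?P|M. exp (- logw \<tau>))"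
      by (auto simp: set_lebesgue_integral_def intro!: Bochner_Integration.integral_nonneg)
    ultimately show ?thesis using K_pos by (simp add: ennreal_mult[symmetric])
  qed
  also have "\<dots> = K0 * K1 * K2 / ?c\<^sup>2 * (?c * R)\<^sup>2"
  proof -
    have "k * r\<^sup>2 = k / q\<^sup>2 * (q * r)\<^sup>2" if "0 < q" for k r q :: real
      using that by (simp add: power_mult_distrib)
    then show ?thesis using c by blast
  qed
  also have "\<dots> \<le> K0 * K1 * K2 / ?c\<^sup>2 * (measure M ?P)\<^sup>2"
  proof (intro mult_left_mono power_mono measure_portion_ge[OF R])
    show "0 \<le> ?c * R" using c R by (intro mult_nonneg_nonneg) auto
    show "0 \<le> K0 * K1 * K2 / ?c\<^sup>2" using K_pos by simp
  qed
  finally have "(LINT \<tau>:?P|M. exp (logw \<tau>)) * (LINT \<tau>:?P|M. exp (- logw \<tau>)) \<le> K0 * K1 * K2 / ?c\<^sup>2 * (measure M ?P)\<^sup>2" .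
  from set_mean_oscillation_le[OF integrable_logw integrable_exp_logw portion_sets emeasure_finite[OF portion_sets] m this]
  show ?thesis by (simp add: mean_eq osc_const_def)
qed

lemma oscillation_integrable:
  assumes "E \<in> sets M"
  shows "set_integrable M E (\<lambda>\<tau>. \<bar>logw \<tau> - c\<bar>)"
proof -
  have "set_integrable M E (\<lambda>_. c)"
    using assms emeasure_finite[OF assms]
    by (auto simp: set_integrable_def less_top intro!: integrable_mult_left)
  then show ?thesis
    by (intro set_integrable_abs set_integral_diff set_integrable_logw assms)
qed

lemma elog_measurable [measurable]: "elog \<in> borel_measurable borel"
  unfolding elog_def[abs_def] by measurable

lemma log_weight_BMO: "(\<lambda>\<tau>. elog (w \<tau>)) \<in> BMO M t"
  unfolding BMO_def mem_Collect_eq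
proof (intro conjI)
  show "(\<lambda>\<tau>. elog (w \<tau>)) \<in> borel_measurable M" by measurable
  show "integrable M (\<lambda>\<tau>. real_of_ereal (elog (w \<tau>)))" using integrable_logw by (simp add: logw_eq[abs_def])
  have elog_logw: "AE \<tau> in M. elog (w \<tau>) = ereal (logw \<tau>)"
    using w_AE by eventually_elim (auto simp: elog_def logw_def)
  then show "AE \<tau> in M. \<bar>elog (w \<tau>)\<bar> < \<infinity>" by eventually_elim simp
  have small: "(\<integral>\<^sup>+ \<tau> \<in> portion M t R. e2ennreal \<bar>elog (w \<tau>) - ereal (\<Omega> R)\<bar> \<partial>M) / emeasure M (portion M t R) \<le> ennreal osc_const"
    if R: "0 < R" "R \<le> D" for R
  proof -
    let ?P = "portion M t R"
    have m: "0 < measure M ?P" by (rule measure_portion_pos[OF R])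
    have "(\<integral>\<^sup>+ \<tau> \<in> ?P. e2ennreal \<bar>elog (w \<tau>) - ereal (\<Omega> R)\<bar> \<partial>M) = (\<integral>\<^sup>+ \<tau>. ennreal \<bar>logw \<tau> - \<Omega> R\<bar> * indicator ?P \<tau> \<partial>M)"
      by (rule nn_integral_cong_AE) (use elog_logw in eventually_elim, simp add: e2ennreal_ereal)
    also have "\<dots> = ennreal (LINT \<tau>:?P|M. \<bar>logw \<tau> - \<Omega> R\<bar>)"
      by (rule nn_set_integral_eq[OF oscillation_integrable]) auto
    also have "\<dots> \<le> ennreal (osc_const * measure M ?P)" by (rule ennreal_leI[OF oscillation_le[OF R]])
    finally have "(\<integral>\<^sup>+ \<tau> \<in> ?P. e2ennreal \<bar>elog (w \<tau>) - ereal (\<Omega> R)\<bar> \<partial>M) / emeasure M ?P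
        \<le> ennreal (osc_const * measure M ?P) / emeasure M ?P"
      by (rule divide_right_mono_ennreal)
    also have "\<dots> = ennreal osc_const" using m osc_const_pos by (simp add: emeasure_eq divide_ennreal)
    finally show ?thesis .
  qed
  have "(\<integral>\<^sup>+ \<tau> \<in> portion M t R. e2ennreal \<bar>elog (w \<tau>) - ereal (\<Omega> R)\<bar> \<partial>M) / emeasure M (portion M t R) \<le> ennreal osc_const"
    if R: "0 < R" for R
  proof (cases "R \<le> D")
    case False
    \<comment> \<open>Both portions are the whole curve, so nothing changes beyond the radius
      \<open>D\<close>.\<close>
    then have "portion M t R = portion M t D" using portion_eq_space[of R] portion_eq_space[of D] by simp
    moreover from this have "\<Omega> R = \<Omega> D" by (simp add: mean_def)
    ultimately show ?thesis using small[of D] D_bounds by simp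
  qed (use small R in simp)
  then have "(SUP R\<in>{0<..}. (\<integral>\<^sup>+ \<tau> \<in> portion M t R. e2ennreal \<bar>elog (w \<tau>) - ereal (\<Omega> R)\<bar> \<partial>M) / emeasure M (portion M t R)) \<le> ennreal osc_const"
    by (intro SUP_least) simp
  also have "\<dots> < \<infinity>" by simp
  finally show "(SUP R\<in>{0<..}. (\<integral>\<^sup>+ \<tau> \<in> portion M t R. e2ennreal \<bar>elog (w \<tau>) - ereal (\<Omega> R)\<bar> \<partial>M) / emeasure M (portion M t R)) < \<infinity>" .
qed

text \<open>The annulus has length at least \<open>R / 4\<close> inside a portion of length at most
  \<open>C * R\<close>. Restricting the oscillation integral to it and normalizing by the smaller
  length therefore costs at most the factor \<open>4 * C\<close>.\<close>

lemma mean_annulus_deviation: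
  assumes R: "0 < R" "R \<le> max_dist M t"
  defines "E \<equiv> annulus M t R"
  shows "\<bar>(LINT \<tau>:E|M. logw \<tau>) / measure M E - \<Omega> R\<bar> \<le> 4 * C * osc_const"
proof -
  let ?P = "portion M t R"
  have [measurable]: "E \<in> sets M" by (simp add: E_def)
  have RD: "R \<le> D" using R by simp
  have m: "R / 4 \<le> measure M E" using measure_annulus_ge[OF R] by (simp add: E_def)
  then have mpos: "0 < measure M E" using R by simp
  have kE: "set_integrable M E (\<lambda>_. \<Omega> R)"
    using emeasure_finite[of E] by (auto simp: set_integrable_def less_top intro!: integrable_mult_left)
  have "(LINT \<tau>:E|M. logw \<tau>) - \<Omega> R * measure M E = (LINT \<tau>:E|M. logw \<tau> - \<Omega> R)"
    using emeasure_finite[of E] by (subst set_integral_diff) (auto intro!: kE set_integrable_logw simp: set_integral_const)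
  also have "\<bar>\<dots>\<bar> \<le> (LINT \<tau>:E|M. \<bar>logw \<tau> - \<Omega> R\<bar>)"
    unfolding set_lebesgue_integral_def
    by (rule order_trans[OF integral_abs_bound]) (simp add: abs_mult)
  also have "\<dots> \<le> (LINT \<tau>:?P|M. \<bar>logw \<tau> - \<Omega> R\<bar>)"
  proof -
    have "integrable M (\<lambda>\<tau>. indicator E \<tau> *\<^sub>R \<bar>logw \<tau> - \<Omega> R\<bar>)" "integrable M (\<lambda>\<tau>. indicator ?P \<tau> *\<^sub>R \<bar>logw \<tau> - \<Omega> R\<bar>)"
      using oscillation_integrable[of E "\<Omega> R"] oscillation_integrable[of ?P "\<Omega> R"] by (auto simp: set_integrable_def)
    then show ?thesis
      unfolding set_lebesgue_integral_def
      by (rule integral_mono) (use annulus_subset[of R] in \<open>auto simp: E_def split: split_indicator\<close>)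
  qed
  also have "\<dots> \<le> osc_const * measure M ?P" by (rule oscillation_le[OF R(1) RD])
  also have "\<dots> \<le> osc_const * (C * R)" using osc_const_pos measure_portion_le[OF R(1)] by (intro mult_left_mono) auto
  also have "\<dots> = 4 * C * osc_const * (R / 4)" by simp
  also have "\<dots> \<le> 4 * C * osc_const * measure M E" using m osc_const_pos C_pos by (intro mult_left_mono) auto
  finally have "\<bar>(LINT \<tau>:E|M. logw \<tau>) - \<Omega> R * measure M E\<bar> \<le> 4 * C * osc_const * measure M E" .
  moreover have "(LINT \<tau>:E|M. logw \<tau>) / measure M E - \<Omega> R = ((LINT \<tau>:E|M. logw \<tau>) - \<Omega> R * measure M E) / measure M E"
    using mpos by (simp add: field_simps)
  ultimately show ?thesis using mpos by (simp add: abs_divide pos_divide_le_eq)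
qed

text \<open>Jensen's inequality bounds both norms from below; since their product is at most \<open>K0 * R\<close>,
  each lower bound is also an upper bound for the other norm.\<close>

lemma annulus_norms:
  obtains c where "0 < c"
    "\<And>R. 0 < R \<Longrightarrow> R \<le> max_dist M t \<Longrightarrow> \<exists>x y. wnorm (annulus M t R) = ennreal x \<and> vnorm (annulus M t R) = ennreal y
      \<and> c * R powr a * exp (\<Omega> R) \<le> x \<and> c * R powr (1 - a) * exp (- \<Omega> R) \<le> y
      \<and> x * y \<le> K0 * R \<and> measure M (annulus M t R) \<le> x * y"
proof -
  define G where "G = 4 * C * osc_const"
  \<comment> \<open>The factor \<open>exp (- G)\<close> pays for replacing the mean \<open>u\<close>
    over the annulus by \<open>\<Omega> R\<close>, the 4 for its length, and \<open>K2\<close>,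
    \<open>K1\<close> for the indicator norms in Hoelder's inequality.\<close>
  define c where "c = min (exp (- G) / (4 * K2)) (exp (- G) / (4 * K1))"
  have c: "0 < c" using K_pos by (simp add: c_def)
  have "\<exists>x y. wnorm (annulus M t R) = ennreal x \<and> vnorm (annulus M t R) = ennreal y
      \<and> c * R powr a * exp (\<Omega> R) \<le> x \<and> c * R powr (1 - a) * exp (- \<Omega> R) \<le> y
      \<and> x * y \<le> K0 * R \<and> measure M (annulus M t R) \<le> x * y"
    if R: "0 < R" "R \<le> max_dist M t" for R
  proof -
    let ?E = "annulus M t R"
    define m where "m = measure M ?E"
    define u where "u = (LINT \<tau>:?E|M. logw \<tau>) / m"
    have m: "R / 4 \<le> m" using measure_annulus_ge[OF R] by (simp add: m_def)
    then have mpos: "0 < m" using R by simp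
    then have ne: "emeasure M ?E \<noteq> 0" by (simp add: emeasure_eq m_def)
    have RD: "R \<le> D" using R by simp
    note facts = annulus_sets annulus_subset R(1) RD ne
    obtain x where x: "wnorm ?E = ennreal x" "0 \<le> x"
      using wnorm_vnorm_finite(1)[OF facts] by (cases "wnorm ?E") auto
    obtain y where y: "vnorm ?E = ennreal y" "0 \<le> y"
      using wnorm_vnorm_finite(2)[OF facts] by (cases "vnorm ?E") auto
    have dev: "\<bar>u - \<Omega> R\<bar> \<le> G"
      using mean_annulus_deviation[OF R] by (simp add: u_def m_def G_def)
    have Rp: "R powr a * R powr (1 - a) = R" using R by (simp flip: powr_add)
    have "ennreal (LINT \<tau>:?E|M. exp (logw \<tau>)) \<le> ennreal (x * (K2 * R powr (1 - a)))"
      using nn_integral_exp_logw_le[OF facts] x K_pos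
      by (simp add: nn_set_integral_eq set_integrable_logw ennreal_mult)
    then have "(LINT \<tau>:?E|M. exp (logw \<tau>)) \<le> x * (K2 * R powr (1 - a))"
      using x K_pos by (subst (asm) ennreal_le_iff) auto
    moreover have "m * exp u \<le> (LINT \<tau>:?E|M. exp (logw \<tau>))"
      unfolding u_def m_def
      by (rule set_Jensen_exp[OF integrable_logw integrable_exp_logw(1) annulus_sets emeasure_finite[OF annulus_sets]])
        (use mpos in \<open>simp add: m_def\<close>)
    ultimately have 1: "m * exp u \<le> x * (K2 * R powr (1 - a))" by simp
    have "c * R powr a * exp (\<Omega> R) * (K2 * R powr (1 - a)) = (c * K2) * (R powr a * R powr (1 - a)) * exp (\<Omega> R)"
      by (simp only: ac_simps)
    also have "\<dots> \<le> (exp (- G) / 4) * R * exp (\<Omega> R)"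
      unfolding Rp using R K_pos by (intro mult_right_mono) (auto simp: c_def min_def field_simps)
    also have "\<dots> = (R / 4) * exp (\<Omega> R - G)" by (simp add: exp_diff exp_minus field_simps)
    also have "\<dots> \<le> m * exp u" using m R dev by (intro mult_mono) auto
    also note 1
    finally have x_ge: "c * R powr a * exp (\<Omega> R) \<le> x"
      using K_pos R by (simp add: mult_le_cancel_right)
    have "ennreal (LINT \<tau>:?E|M. exp (- logw \<tau>)) \<le> ennreal (K1 * R powr a * y)"
      using nn_integral_exp_minus_logw_le[OF facts] y K_pos
      by (simp add: nn_set_integral_eq set_integrable_logw ennreal_mult)
    then have "(LINT \<tau>:?E|M. exp (- logw \<tau>)) \<le> y * (K1 * R powr a)"
      using y K_pos by (subst (asm) ennreal_le_iff) (auto simp: mult.commute)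
    moreover have "m * exp ((LINT \<tau>:?E|M. - logw \<tau>) / m) \<le> (LINT \<tau>:?E|M. exp (- logw \<tau>))"
      unfolding m_def
      by (rule set_Jensen_exp[OF _ integrable_exp_logw(2) annulus_sets emeasure_finite[OF annulus_sets]])
        (use mpos integrable_logw in \<open>auto simp: m_def\<close>)
    moreover have "(LINT \<tau>:?E|M. - logw \<tau>) / m = - u" by (simp add: u_def set_lebesgue_integral_def)
    ultimately have 2: "m * exp (- u) \<le> y * (K1 * R powr a)" by simp
    have "c * R powr (1 - a) * exp (- \<Omega> R) * (K1 * R powr a) = (c * K1) * (R powr a * R powr (1 - a)) * exp (- \<Omega> R)"
      by (simp only: ac_simps)
    also have "\<dots> \<le> (exp (- G) / 4) * R * exp (- \<Omega> R)"
      unfolding Rp using R K_pos by (intro mult_right_mono) (auto simp: c_def min_def field_simps)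
    also have "\<dots> = (R / 4) * exp (- \<Omega> R - G)" by (simp add: exp_diff exp_minus field_simps)
    also have "\<dots> \<le> m * exp (- u)" using m R dev by (intro mult_mono) auto
    also note 2
    finally have y_ge: "c * R powr (1 - a) * exp (- \<Omega> R) \<le> y"
      using K_pos R by (simp add: mult_le_cancel_right)
    have xy: "ennreal (x * y) \<le> ennreal (K0 * R)" "ennreal m \<le> ennreal (x * y)"
      using wnorm_vnorm_le[OF facts] emeasure_le_wnorm_vnorm[OF facts]
      unfolding x(1) y(1) using x(2) y(2) by (simp_all add: ennreal_mult emeasure_eq m_def)
    have "x * y \<le> K0 * R" "m \<le> x * y"
      using xy K_pos R x y by (simp_all add: ennreal_le_iff)
    then show ?thesis using x y x_ge y_ge by (auto simp: m_def)
  qed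
  then show thesis using that c by blast
qed

end

section \<open>Comparison of the two index functions\<close>

text \<open>The common shape of \<open>Q_fun\<close> and \<open>V_fun\<close>. For positive
  \<open>x\<close> it is the supremum of \<open>F R1 R2\<close> over all radii in
  \<open>{0<..d}\<close> with \<open>R1 / R2 = x\<close>; the case distinction lets the larger
  radius run freely.\<close>

definition ratio_sup :: "real \<Rightarrow> (real \<Rightarrow> real \<Rightarrow> ennreal) \<Rightarrow> real \<Rightarrow> ennreal" where
  "ratio_sup d F x =
     (if x \<le> 1 then SUP R\<in>{0<..d}. F (x * R) R else SUP R\<in>{0<..d}. F R (inverse x * R))"

lemma ratio_sup_upper:
  assumes "0 < R1" "R1 \<le> d" "0 < R2" "R2 \<le> d"
  shows "F R1 R2 \<le> ratio_sup d F (R1 / R2)"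
proof (cases "R1 / R2 \<le> 1")
  case True
  show ?thesis unfolding ratio_sup_def if_P[OF True]
    by (rule SUP_upper2[of R2]) (use assms in auto)
next
  case False
  show ?thesis unfolding ratio_sup_def if_not_P[OF False]
    by (rule SUP_upper2[of R1]) (use assms in auto)
qed

lemma ratio_sup_least:
  assumes "0 < x"
    and "\<And>R1 R2. 0 < R1 \<Longrightarrow> R1 \<le> d \<Longrightarrow> 0 < R2 \<Longrightarrow> R2 \<le> d \<Longrightarrow> R1 / R2 = x \<Longrightarrow> F R1 R2 \<le> y"
  shows "ratio_sup d F x \<le> y"
proof (cases "x \<le> 1")
  case True
  show ?thesis unfolding ratio_sup_def if_P[OF True]
  proof (rule SUP_least, rule assms(2))
    fix R assume R: "R \<in> {0<..d}"
    then have "x * R \<le> 1 * R" using True by (intro mult_right_mono) auto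
    also have "\<dots> \<le> d" using R by simp
    finally show "x * R \<le> d" .
  qed (use assms in auto)
next
  case False
  show ?thesis unfolding ratio_sup_def if_not_P[OF False]
  proof (rule SUP_least, rule assms(2))
    fix R assume R: "R \<in> {0<..d}"
    have "inverse x * R \<le> 1 * R" using False R by (intro mult_right_mono) (auto simp: field_simps)
    also have "\<dots> \<le> d" using R by simp
    finally show "inverse x * R \<le> d" .
    show "R / (inverse x * R) = x" using R assms(1) by (simp add: field_simps)
  qed (use assms in auto)
qed

lemma ratio_sup_submult:
  assumes F: "\<And>R1 R2 R3. 0 < R1 \<Longrightarrow> R1 \<le> d \<Longrightarrow> 0 < R2 \<Longrightarrow> R2 \<le> d \<Longrightarrow> 0 < R3 \<Longrightarrow> R3 \<le> d \<Longrightarrow>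
      F R1 R3 \<le> F R1 R2 * F R2 R3"
    and xy: "0 < x" "0 < y" "x < 1 \<and> y < 1 \<or> 1 < x \<and> 1 < y"
  shows "ratio_sup d F (x * y) \<le> ratio_sup d F x * ratio_sup d F y"
proof (rule ratio_sup_least)
  fix R1 R3 assume R: "0 < R1" "R1 \<le> d" "0 < R3" "R3 \<le> d" and eq: "R1 / R3 = x * y"
  define R2 where "R2 = y * R3"
  have R1: "R1 = x * R2" using eq R by (simp add: R2_def field_simps)
  have R2: "0 < R2" using R xy by (simp add: R2_def)
  have "R2 \<le> d"
  proof (cases "y < 1")
    case True
    then have "R2 \<le> 1 * R3" unfolding R2_def using R by (intro mult_right_mono) auto
    then show ?thesis using R by simp
  next
    case False
    then have "1 * R2 \<le> R1" unfolding R1 using R2 xy by (intro mult_right_mono) auto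
    then show ?thesis using R by simp
  qed
  then have "F R1 R3 \<le> F R1 R2 * F R2 R3" using R R2 by (intro F) auto
  also have "\<dots> \<le> ratio_sup d F (R1 / R2) * ratio_sup d F (R2 / R3)"
    using R R2 \<open>R2 \<le> d\<close> by (intro mult_mono ratio_sup_upper) auto
  also have "R1 / R2 = x" using R1 R2 by simp
  also have "R2 / R3 = y" using R by (simp add: R2_def)
  finally show "F R1 R3 \<le> ratio_sup d F x * ratio_sup d F y" .
qed (use xy in simp)

lemma ratio_sup_compare:
  assumes F: "\<And>R1 R2. 0 < R1 \<Longrightarrow> R1 \<le> d \<Longrightarrow> 0 < R2 \<Longrightarrow> R2 \<le> d \<Longrightarrow>
      F R1 R2 \<le> ennreal (K * (R1 / R2) powr b) * H R1 R2"
    and x: "0 < x"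
  shows "ratio_sup d F x \<le> ennreal (K * x powr b) * ratio_sup d H x"
proof (rule ratio_sup_least[OF x])
  fix R1 R2 assume R: "0 < R1" "R1 \<le> d" "0 < R2" "R2 \<le> d" and eq: "R1 / R2 = x"
  have "F R1 R2 \<le> ennreal (K * (R1 / R2) powr b) * H R1 R2" using R by (intro F)
  also have "\<dots> \<le> ennreal (K * (R1 / R2) powr b) * ratio_sup d H (R1 / R2)"
    using R by (intro mult_left_mono ratio_sup_upper) auto
  finally show "F R1 R2 \<le> ennreal (K * x powr b) * ratio_sup d H x" by (simp add: eq)
qed

lemma Q_fun_eq: "Q_fun M p t w = ratio_sup (max_dist M t) (G_fun M p t w)"
  by (rule ext) (simp add: Q_fun_def ratio_sup_def)

lemma V_fun_eq: "V_fun M t w = ratio_sup (max_dist M t) (H_fun M t w)"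
  by (rule ext) (simp add: V_fun_def ratio_sup_def)

context weighted_carleson_point
begin

lemma G_fun_eq:
  assumes "wnorm (annulus M t R1) = ennreal x" "vnorm (annulus M t R2) = ennreal y" "0 \<le> x" "0 \<le> y"
    and "0 < R2" "R2 \<le> max_dist M t"
  shows "G_fun M p t w R1 R2 = ennreal (x * y / measure M (annulus M t R2))"
proof -
  have "0 < measure M (annulus M t R2)" using measure_annulus_ge[of R2] assms by linarith
  then show ?thesis
    unfolding G_fun_def assms(1,2) emeasure_eq[OF annulus_sets] using assms(3,4)
    by (simp add: ennreal_mult[symmetric] divide_ennreal)
qed

text \<open>Each norm on an annulus is known up to constants:
  \<open>R powr a * exp (\<Omega> R)\<close> for \<open>w\<close> and
  \<open>R powr (1 - a) * exp (- \<Omega> R)\<close> for \<open>1/w\<close>. Dividing by the length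
  of the second annulus, of order \<open>R2\<close>, turns \<open>R2 powr (1 - a)\<close> into
  \<open>R2 powr (- a)\<close>.\<close>

lemma G_fun_compare:
  obtains K where "0 < K"
    "\<And>R1 R2. 0 < R1 \<Longrightarrow> R1 \<le> max_dist M t \<Longrightarrow> 0 < R2 \<Longrightarrow> R2 \<le> max_dist M t \<Longrightarrow>
      G_fun M p t w R1 R2 \<le> ennreal (K * (R1 / R2) powr a) * H_fun M t w R1 R2"
    "\<And>R1 R2. 0 < R1 \<Longrightarrow> R1 \<le> max_dist M t \<Longrightarrow> 0 < R2 \<Longrightarrow> R2 \<le> max_dist M t \<Longrightarrow>
      H_fun M t w R1 R2 \<le> ennreal (K * (R1 / R2) powr (- a)) * G_fun M p t w R1 R2"
proof -
  obtain c where c: "0 < c" and norms: "\<And>R. 0 < R \<Longrightarrow> R \<le> max_dist M t \<Longrightarrow>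
      \<exists>x y. wnorm (annulus M t R) = ennreal x \<and> vnorm (annulus M t R) = ennreal y
      \<and> c * R powr a * exp (\<Omega> R) \<le> x \<and> c * R powr (1 - a) * exp (- \<Omega> R) \<le> y
      \<and> x * y \<le> K0 * R \<and> measure M (annulus M t R) \<le> x * y"
    by (rule annulus_norms) blast
  \<comment> \<open>The first entry combines two upper bounds \<open>K0 / c\<close> for norms with
    length at least \<open>R2 / 4\<close>; the second combines two lower bounds \<open>c\<close>
    with length at most \<open>C * R2\<close>.\<close>
  define K where "K = max (4 * (K0 / c)\<^sup>2) (C / c\<^sup>2)"
  have K: "0 < K" "4 * (K0 / c)\<^sup>2 \<le> K" "C / c\<^sup>2 \<le> K"
    using C_pos c by (auto simp: K_def less_max_iff_disj)
  have "G_fun M p t w R1 R2 \<le> ennreal (K * (R1 / R2) powr a) * H_fun M t w R1 R2 \<and>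
      H_fun M t w R1 R2 \<le> ennreal (K * (R1 / R2) powr (- a)) * G_fun M p t w R1 R2"
    if R1: "0 < R1" "R1 \<le> max_dist M t" and R2: "0 < R2" "R2 \<le> max_dist M t" for R1 R2
  proof -
    define P1 S1 e1 P2 S2 e2 m where defs: "P1 = R1 powr a" "S1 = R1 powr (1 - a)" "e1 = exp (\<Omega> R1)"
      "P2 = R2 powr a" "S2 = R2 powr (1 - a)" "e2 = exp (\<Omega> R2)" "m = measure M (annulus M t R2)"
    have pos: "0 < P1" "0 < S1" "0 < e1" "0 < P2" "0 < S2" "0 < e2" using R1 R2 by (auto simp: defs)
    have PS: "P1 * S1 = R1" "P2 * S2 = R2" using R1 R2 by (simp_all add: defs flip: powr_add)
    obtain x1 y1 where xy1: "wnorm (annulus M t R1) = ennreal x1"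
      "c * P1 * e1 \<le> x1" "c * S1 / e1 \<le> y1" "x1 * y1 \<le> K0 * (P1 * S1)"
      using norms[OF R1] unfolding PS by (auto simp: defs exp_minus field_simps)
    obtain x2 y2 where xy2: "vnorm (annulus M t R2) = ennreal y2"
      "c * P2 * e2 \<le> x2" "c * S2 / e2 \<le> y2" "x2 * y2 \<le> K0 * (P2 * S2)"
      using norms[OF R2] unfolding PS by (auto simp: defs exp_minus field_simps)
    have x1_pos: "0 < x1" using xy1(2) pos c by (meson less_le_trans mult_pos_pos)
    have y2_pos: "0 < y2" using xy2(3) pos c by (meson less_le_trans mult_pos_pos divide_pos_pos)
    have m: "P2 * S2 / 4 \<le> m" "m \<le> C * (P2 * S2)"
    proof -
      show "P2 * S2 / 4 \<le> m" using measure_annulus_ge[OF R2] by (simp add: defs(7) PS)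
      have "m \<le> measure M (portion M t R2)"
        unfolding defs(7) by (intro measure_mono annulus_subset) auto
      then show "m \<le> C * (P2 * S2)" using measure_portion_le[OF R2(1)] by (simp add: PS)
    qed
    have mpos: "0 < m" using m(1) mult_pos_pos[OF pos(4,5)] by linarith
    have G: "G_fun M p t w R1 R2 = ennreal (x1 * y2 / m)"
      unfolding defs(7) by (rule G_fun_eq[OF xy1(1) xy2(1) _ _ R2]) (use x1_pos y2_pos in auto)
    have H: "H_fun M t w R1 R2 = ennreal (e1 / e2)" by (simp add: H_fun_def defs)
    have ratio: "(R1 / R2) powr a = P1 / P2" "(R1 / R2) powr (- a) = P2 / P1"
      using R1 R2 by (simp_all add: defs powr_divide powr_minus field_simps)
    have "x1 * (c * S1 / e1) \<le> x1 * y1" using xy1(3) x1_pos by (intro mult_left_mono) auto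
    then have "x1 * (c * S1 / e1) \<le> K0 * (P1 * S1)" using xy1(4) by linarith
    then have x1_le: "x1 \<le> K0 / c * (P1 * e1)" using pos c by (simp add: field_simps)
    have "(c * P2 * e2) * y2 \<le> x2 * y2" using xy2(2) y2_pos by (intro mult_right_mono) auto
    then have "(c * P2 * e2) * y2 \<le> K0 * (P2 * S2)" using xy2(4) by linarith
    then have y2_le: "y2 \<le> K0 / c * (S2 / e2)" using pos c by (simp add: field_simps)
    have "x1 * y2 / m \<le> (K0 / c * (P1 * e1)) * (K0 / c * (S2 / e2)) / (P2 * S2 / 4)"
      using x1_le y2_le x1_pos y2_pos m(1) mpos pos
      by (intro frac_le mult_mono mult_nonneg_nonneg) (use K_pos c in auto)
    also have "\<dots> = 4 * (K0 / c)\<^sup>2 * (P1 / P2) * (e1 / e2)"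
      using pos c by (simp add: field_simps power2_eq_square)
    also have "\<dots> \<le> K * (P1 / P2) * (e1 / e2)"
      using K pos by (intro mult_right_mono) auto
    finally have upper: "x1 * y2 / m \<le> K * (P1 / P2) * (e1 / e2)" .
    \<comment> \<open>Arranged so that the last factor is the product of the lower bounds for
      \<open>x1\<close> and \<open>y2\<close> over the upper bound for \<open>m\<close>.\<close>
    have "e1 / e2 = C / c\<^sup>2 * (P2 / P1) * ((c * P1 * e1) * (c * S2 / e2) / (C * (P2 * S2)))"
      using pos c C_pos by (simp add: field_simps power2_eq_square)
    also have "\<dots> \<le> C / c\<^sup>2 * (P2 / P1) * (x1 * y2 / m)"
      using xy1(2) xy2(3) m(2) mpos pos x1_pos y2_pos C_pos c
      by (intro mult_left_mono frac_le mult_mono) auto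
    also have "\<dots> \<le> K * (P2 / P1) * (x1 * y2 / m)"
      using K pos x1_pos y2_pos mpos by (intro mult_right_mono) auto
    finally have lower: "e1 / e2 \<le> K * (P2 / P1) * (x1 * y2 / m)" .
    show ?thesis
      unfolding G H ratio
      using upper lower K(1) pos x1_pos y2_pos mpos by (simp add: ennreal_mult[symmetric] ennreal_leI)
  qed
  then show thesis using that K(1) by blast
qed

text \<open>Hoelder's inequality on the middle annulus makes the product of its two norms, divided
  by its length, at least 1; inserting this quotient splits \<open>G_fun\<close> into two
  factors.\<close>

lemma G_fun_submult:
  assumes R1: "0 < R1" "R1 \<le> max_dist M t" and R2: "0 < R2" "R2 \<le> max_dist M t"
    and R3: "0 < R3" "R3 \<le> max_dist M t"
  shows "G_fun M p t w R1 R3 \<le> G_fun M p t w R1 R2 * G_fun M p t w R2 R3"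
proof -
  have ex: "\<exists>x y. wnorm (annulus M t R) = ennreal x \<and> vnorm (annulus M t R) = ennreal y \<and> 0 \<le> x \<and> 0 \<le> y
      \<and> measure M (annulus M t R) \<le> x * y \<and> 0 < measure M (annulus M t R)"
    if R: "0 < R" "R \<le> max_dist M t" for R
  proof -
    obtain c where "0 < c" "\<exists>x y. wnorm (annulus M t R) = ennreal x \<and> vnorm (annulus M t R) = ennreal y
      \<and> c * R powr a * exp (\<Omega> R) \<le> x \<and> c * R powr (1 - a) * exp (- \<Omega> R) \<le> y
      \<and> x * y \<le> K0 * R \<and> measure M (annulus M t R) \<le> x * y"
      by (rule annulus_norms) (use R in blast)
    then obtain x y where xy: "wnorm (annulus M t R) = ennreal x" "vnorm (annulus M t R) = ennreal y"
      "c * R powr a * exp (\<Omega> R) \<le> x" "c * R powr (1 - a) * exp (- \<Omega> R) \<le> y"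
      "measure M (annulus M t R) \<le> x * y" by blast
    moreover have "0 \<le> c * R powr a * exp (\<Omega> R)" "0 \<le> c * R powr (1 - a) * exp (- \<Omega> R)"
      using \<open>0 < c\<close> by simp_all
    moreover have "0 < measure M (annulus M t R)" using measure_annulus_ge[OF R] R by linarith
    ultimately show ?thesis by (meson order_trans)
  qed
  obtain x1 where x1: "wnorm (annulus M t R1) = ennreal x1" "0 \<le> x1" using ex[OF R1] by blast
  obtain x2 y2 where x2: "wnorm (annulus M t R2) = ennreal x2" "vnorm (annulus M t R2) = ennreal y2" "0 \<le> x2" "0 \<le> y2"
      "measure M (annulus M t R2) \<le> x2 * y2" "0 < measure M (annulus M t R2)" using ex[OF R2] by blast
  obtain y3 where y3: "vnorm (annulus M t R3) = ennreal y3" "0 \<le> y3" "0 < measure M (annulus M t R3)"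
    using ex[OF R3] by blast
  define m2 where "m2 = measure M (annulus M t R2)"
  define m3 where "m3 = measure M (annulus M t R3)"
  have m: "0 < m2" "0 < m3" "m2 \<le> x2 * y2" using x2 y3 by (auto simp: m2_def m3_def)
  have "x1 * y3 / m3 = x1 * y3 / m3 * 1" by simp
  also have "\<dots> \<le> x1 * y3 / m3 * (x2 * y2 / m2)"
    using m x1 y3 by (intro mult_left_mono) (auto simp: pos_le_divide_eq)
  also have "\<dots> = (x1 * y2 / m2) * (x2 * y3 / m3)" by (simp add: ac_simps)
  finally have "ennreal (x1 * y3 / m3) \<le> ennreal ((x1 * y2 / m2) * (x2 * y3 / m3))" by (rule ennreal_leI)
  also have "\<dots> = ennreal (x1 * y2 / m2) * ennreal (x2 * y3 / m3)"
    by (rule ennreal_mult) (use m x1 x2 y3 in auto)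
  finally show ?thesis
    unfolding G_fun_eq[OF x1(1) y3(1) x1(2) y3(2) R3] G_fun_eq[OF x1(1) x2(2) x1(2) x2(4) R2]
      G_fun_eq[OF x2(1) y3(1) x2(3) y3(2) R3] m2_def m3_def .
qed

lemma H_fun_submult: "H_fun M t w R1 R3 \<le> H_fun M t w R1 R2 * H_fun M t w R2 R3"
  by (simp add: H_fun_def ennreal_mult[symmetric])

lemma index_formulas:
  "lower_index (Q_fun M p t w) = ereal a + lower_index (V_fun M t w)"
  "upper_index (Q_fun M p t w) = ereal a + upper_index (V_fun M t w)"
proof -
  obtain K where K: "0 < K"
    and le: "\<And>R1 R2. 0 < R1 \<Longrightarrow> R1 \<le> max_dist M t \<Longrightarrow> 0 < R2 \<Longrightarrow> R2 \<le> max_dist M t \<Longrightarrow>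
      G_fun M p t w R1 R2 \<le> ennreal (K * (R1 / R2) powr a) * H_fun M t w R1 R2"
    and ge: "\<And>R1 R2. 0 < R1 \<Longrightarrow> R1 \<le> max_dist M t \<Longrightarrow> 0 < R2 \<Longrightarrow> R2 \<le> max_dist M t \<Longrightarrow>
      H_fun M t w R1 R2 \<le> ennreal (K * (R1 / R2) powr (- a)) * G_fun M p t w R1 R2"
    by (rule G_fun_compare) blast
  show "lower_index (Q_fun M p t w) = ereal a + lower_index (V_fun M t w)"
    unfolding Q_fun_eq V_fun_eq
    by (rule lower_index_compare[OF _ _ _ _ K])
      (auto intro!: ratio_sup_submult ratio_sup_compare G_fun_submult H_fun_submult le ge)
  show "upper_index (Q_fun M p t w) = ereal a + upper_index (V_fun M t w)"
    unfolding Q_fun_eq V_fun_eq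
    by (rule upper_index_compare[OF _ _ _ _ K])
      (auto intro!: ratio_sup_submult ratio_sup_compare G_fun_submult H_fun_submult le ge)
qed

end

lemma SUP_divide_finiteD:
  fixes h :: "real \<Rightarrow> ennreal"
  assumes "(SUP R\<in>{0<..}. h R / ennreal R) < \<infinity>"
  obtains K where "0 < K" "\<And>R. 0 < R \<Longrightarrow> h R \<le> ennreal (K * R)"
proof -
  define s where "s = (SUP R\<in>{0<..}. h R / ennreal R)"
  obtain k where k: "s = ennreal k" "0 \<le> k" using assms unfolding s_def[symmetric] by (cases s) auto
  \<comment> \<open>The supremum \<open>k\<close> may be 0; adding 1 makes the constant
    positive.\<close>
  have "h R \<le> ennreal ((k + 1) * R)" if R: "0 < R" for R
  proof -
    have "h R / ennreal R \<le> s" unfolding s_def by (rule SUP_upper) (use R in simp)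
    then have "ennreal R * (h R / ennreal R) \<le> ennreal R * s" by (rule mult_left_mono) simp
    also have "ennreal R * (h R / ennreal R) = h R"
      using R by (simp add: ennreal_times_divide mult.commute[of "ennreal R"] ennreal_mult_divide_eq)
    also have "ennreal R * s = ennreal (R * k)" unfolding k(1) using R k by (simp add: ennreal_mult)
    also have "\<dots> \<le> ennreal ((k + 1) * R)" using R by (intro ennreal_leI) (simp add: algebra_simps)
    finally show ?thesis .
  qed
  then show thesis using k by (intro that[of "k + 1"]) auto
qed

theorem theorem5p9:
  fixes g :: "real \<Rightarrow> complex" and t :: complex
    and w :: "complex \<Rightarrow> ennreal" and p :: "complex \<Rightarrow> real"
  assumes "rectifiable_jordan_curve g"
    and "t \<in> path_image g"
    and "locally_Carleson (arclength_measure g) t"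
    and "weight (arclength_measure g) w"
    and "p \<in> exponent_class (arclength_measure g) t"
    and "w \<in> A_class (arclength_measure g) p t"
  shows "(\<lambda>\<tau>. elog (w \<tau>)) \<in> BMO (arclength_measure g) t
    \<and> lower_index (Q_fun (arclength_measure g) p t w)
        = ereal (1 / p t) + lower_index (V_fun (arclength_measure g) t w)
    \<and> upper_index (Q_fun (arclength_measure g) p t w)
        = ereal (1 / p t) + upper_index (V_fun (arclength_measure g) t w)"
proof -
  define M where "M = arclength_measure g"
  have sp: "space M = path_image g" by (simp add: M_def)
  obtain C where C: "0 < C" "\<And>R. 0 < R \<Longrightarrow> emeasure M (portion M t R) \<le> ennreal (C * R)"
    using SUP_divide_finiteD assms(3) unfolding locally_Carleson_def M_def[symmetric] by metis
  obtain K0 where K0: "0 < K0" "\<And>R. 0 < R \<Longrightarrow> nakano_norm M p (\<lambda>\<tau>. w \<tau> * indicator (portion M t R) \<tau>)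
            * associate_norm M p (\<lambda>\<tau>. indicator (portion M t R) \<tau> / w \<tau>) \<le> ennreal (K0 * R)"
  proof (rule SUP_divide_finiteD)
    show "(SUP R\<in>{0<..}. nakano_norm M p (\<lambda>\<tau>. w \<tau> * indicator (portion M t R) \<tau>)
            * associate_norm M p (\<lambda>\<tau>. indicator (portion M t R) \<tau> / w \<tau>) / ennreal R) < \<infinity>"
      using assms(6) unfolding A_class_def M_def[symmetric] by simp
  qed (blast intro: that)
  have p: "continuous_on (path_image g) p" "\<And>\<tau>. \<tau> \<in> path_image g \<Longrightarrow> 1 < p \<tau>"
    using assms(5) by (auto simp: exponent_class_def)
  obtain L where L: "0 < L" "\<And>\<tau>. \<tau> \<in> portion M t (1/2) \<Longrightarrow> \<bar>p \<tau> - p t\<bar> \<le> L / (- ln (cmod (\<tau> - t)))"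
    using assms(5) unfolding exponent_class_def M_def[symmetric] by blast
  have "p \<in> borel_measurable (restrict_space borel (path_image g))"
    by (rule borel_measurable_continuous_on_restrict[OF p(1)])
  then have pm: "p \<in> borel_measurable M"
    unfolding M_def arclength_measure_def by (intro measurable_completion) simp
  interpret carleson_point M t p C L
  proof
    show "portion M t R \<in> sets M" for R
      unfolding M_def by (intro sets_arclength_measure portion_sets_borel assms(1))
    show "ennreal (R / 4) \<le> emeasure M (annulus M t R)" if "0 < R" "R \<le> max_dist M t" for R
      using emeasure_annulus_ge[OF assms(1,2)] that unfolding M_def by blast
    show "0 < max_dist M t" unfolding M_def by (rule max_dist_pos[OF assms(1)])
    show "cmod (\<tau> - t) \<le> max_dist M t" if "\<tau> \<in> space M" for \<tau>
      using cmod_le_max_dist[OF assms(1)] that unfolding sp unfolding M_def by blast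
    show "1 < p \<tau>" if "\<tau> \<in> space M" for \<tau> using p(2) that unfolding sp .
  qed (use C L p(2) pm assms(2) in auto)
  obtain K1 where K1: "0 < K1"
    "\<And>R. 0 < R \<Longrightarrow> R \<le> D \<Longrightarrow> nakano_norm M p (indicator (portion M t R)) \<le> ennreal (K1 * R powr a)"
    by (rule nakano_norm_portion) blast
  obtain K2 where K2: "0 < K2"
    "\<And>R. 0 < R \<Longrightarrow> R \<le> D \<Longrightarrow> associate_norm M p (indicator (portion M t R)) \<le> ennreal (K2 * R powr (1 - a))"
    by (rule associate_norm_portion) blast
  interpret weighted_carleson_point M t p C L w K0 K1 K2
    by unfold_locales (use assms(4) K0 K1 K2 in \<open>auto simp: weight_def M_def[symmetric]\<close>)
  show ?thesis
    using log_weight_BMO index_formulas unfolding M_def[symmetric] by blast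
qed

end
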